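(* Let $n\ge 3$ and let $G$ be the group with generators $R_1,\dots,R_{n-1}$ and relations $$R_iR_{i+1}R_i=R_{i+1}R_iR_{i+1}\ (1\le i\le n-2),\qquad R_iR_j=R_jR_i\ (|i-j|\ge 2),\qquad R_1^{2}=R_2R_1^{2}R_2,$$ i.e. the quotient of the braid group $B_n$ by the one additional relation $R_1^2=R_2R_1^2R_2$. Then $G$ has order $2^n n!$ and is a nontrivial double cover of the rotational hyperoctahedral group $G'$ in dimension $n$: there is a non-split central extension $$1\to \mathbb{Z}/2\mathbb{Z}\to G\to G'\to 1 .$$
   Context: The rotational hyperoctahedral group $G'\subset SO(n)$ is the group of all elements of $SO(n)$ that permute the $2n$ vertices $\pm e_1,\dots,\pm e_n$ of the hyperoctahedron in $\mathbb{R}^n$, where $e_1,\dots,e_n$ is the standard basis. An extension is called nontrivial if the corresponding short exact sequence does not split (semidirect products, in particular direct products, are regarded as trivial). *)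

theory Defs
  imports "HOL-Algebra.Elementary_Groups" "Jordan_Normal_Form.Determinant"
begin

section \<open>Groups given by generators and relations\<close>

text \<open>
  The letter \<open>(s, True)\<close> stands for the generator \<open>s\<close>, the letter \<open>(s, False)\<close> for its inverse.
  A relation \<open>u = v\<close> is the pair \<open>(u, v)\<close> of words.
\<close>

type_synonym 'a gword = "('a \<times> bool) list"

abbreviation gwords :: "'a set \<Rightarrow> 'a gword set"
  where "gwords S \<equiv> lists (S \<times> UNIV)"

text \<open>
  The least congruence on the words over \<open>S\<close> that identifies the two sides of every relation and
  makes the two letters belonging to a generator inverse to each other. Pairs in \<open>rels\<close> that are
  not words over \<open>S\<close> are ignored.
\<close>

inductive pres_eq :: "'a set \<Rightarrow> ('a gword \<times> 'a gword) set \<Rightarrow> 'a gword \<Rightarrow> 'a gword \<Rightarrow> bool"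
  for S :: "'a set" and rels :: "('a gword \<times> 'a gword) set"
where
  refl: "w \<in> gwords S \<Longrightarrow> pres_eq S rels w w"
| sym: "pres_eq S rels u v \<Longrightarrow> pres_eq S rels v u"
| trans: "pres_eq S rels u v \<Longrightarrow> pres_eq S rels v w \<Longrightarrow> pres_eq S rels u w"
| append: "pres_eq S rels u u' \<Longrightarrow> pres_eq S rels v v' \<Longrightarrow> pres_eq S rels (u @ v) (u' @ v')"
| cancel: "s \<in> S \<Longrightarrow> pres_eq S rels [(s, b), (s, \<not> b)] []"
| relation: "(u, v) \<in> rels \<Longrightarrow> u \<in> gwords S \<Longrightarrow> v \<in> gwords S \<Longrightarrow> pres_eq S rels u v"

definition pres_rel :: "'a set \<Rightarrow> ('a gword \<times> 'a gword) set \<Rightarrow> ('a gword \<times> 'a gword) set"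
  where "pres_rel S rels = {(u, v). pres_eq S rels u v}"

definition presented_group :: "'a set \<Rightarrow> ('a gword \<times> 'a gword) set \<Rightarrow> 'a gword set monoid"
  where "presented_group S rels =
    \<lparr>carrier = gwords S // pres_rel S rels,
     monoid.mult = (\<lambda>A B. \<Union>u\<in>A. \<Union>v\<in>B. pres_rel S rels `` {u @ v}),
     one = pres_rel S rels `` {[]}\<rparr>"

lemma pres_eq_gwords: "pres_eq S rels u v \<Longrightarrow> u \<in> gwords S \<and> v \<in> gwords S"
  by (induction rule: pres_eq.induct) auto

lemma equiv_pres_rel: "equiv (gwords S) (pres_rel S rels)"
proof (rule equivI)
  show "pres_rel S rels \<subseteq> gwords S \<times> gwords S"
    unfolding pres_rel_def using pres_eq_gwords by blast
  show "refl_on (gwords S) (pres_rel S rels)"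
    unfolding refl_on_def pres_rel_def by (auto intro: pres_eq.refl)
  show "Relation.sym (pres_rel S rels)"
    unfolding sym_def pres_rel_def by (auto intro: pres_eq.sym)
  show "Relation.trans (pres_rel S rels)"
    unfolding trans_def pres_rel_def by (auto intro: pres_eq.trans)
qed

lemma pres_class_eq_iff:
  assumes "u \<in> gwords S" "v \<in> gwords S"
  shows "pres_rel S rels `` {u} = pres_rel S rels `` {v} \<longleftrightarrow> pres_eq S rels u v"
  using eq_equiv_class_iff[OF equiv_pres_rel assms] by (simp add: pres_rel_def)

lemma presented_group_mult:
  assumes "u \<in> gwords S" "v \<in> gwords S"
  shows "pres_rel S rels `` {u} \<otimes>\<^bsub>presented_group S rels\<^esub> pres_rel S rels `` {v}
    = pres_rel S rels `` {u @ v}"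
proof -
  let ?C = "\<lambda>w. pres_rel S rels `` {w}"
  have "?C (u' @ v') = ?C (u @ v)" if "u' \<in> ?C u" "v' \<in> ?C v" for u' v'
  proof -
    have eq: "pres_eq S rels (u @ v) (u' @ v')"
      using that by (intro pres_eq.append) (simp_all add: pres_rel_def)
    then show ?thesis
      using pres_eq_gwords[OF eq] pres_class_eq_iff[of "u @ v" S "u' @ v'" rels] by simp
  qed
  moreover have "u \<in> ?C u" "v \<in> ?C v"
    using assms by (simp_all add: pres_rel_def pres_eq.refl)
  ultimately have "(\<Union>u'\<in>?C u. \<Union>v'\<in>?C v. ?C (u' @ v')) = ?C (u @ v)"
    by blast
  then show ?thesis
    by (simp add: presented_group_def)
qed

lemma presented_group_carrierE:
  assumes "x \<in> carrier (presented_group S rels)"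
  obtains w where "w \<in> gwords S" "x = pres_rel S rels `` {w}"
  using assms by (auto simp: presented_group_def quotient_def)

lemma presented_group_class_closed:
  "w \<in> gwords S \<Longrightarrow> pres_rel S rels `` {w} \<in> carrier (presented_group S rels)"
  by (simp add: presented_group_def quotientI)

definition inv_gword :: "'a gword \<Rightarrow> 'a gword"
  where "inv_gword w = rev (map (apsnd Not) w)"

lemma inv_gword_closed: "w \<in> gwords S \<Longrightarrow> inv_gword w \<in> gwords S"
  by (induction w) (simp_all add: inv_gword_def mem_Times_iff)

lemma inv_gword_cancel:
  assumes "w \<in> gwords S"
  shows "pres_eq S rels (inv_gword w @ w) []"
  using assms
proof (induction w rule: list.induct)
  case Nil
  then show ?case by (auto simp: inv_gword_def intro: pres_eq.refl)
next
  case (Cons x w)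
  obtain s b where x: "x = (s, b)" by (cases x)
  have s: "s \<in> S" and w: "w \<in> gwords S"
    using Cons.prems x by simp_all
  have "pres_eq S rels [(s, \<not> b), (s, b)] []"
    using pres_eq.cancel[OF s, of rels "\<not> b"] by simp
  then have "pres_eq S rels ([(s, \<not> b), (s, b)] @ w) ([] @ w)"
    by (rule pres_eq.append) (rule pres_eq.refl[OF w])
  then have "pres_eq S rels (inv_gword w @ [(s, \<not> b), (s, b)] @ w) (inv_gword w @ [] @ w)"
    by (rule pres_eq.append[OF pres_eq.refl[OF inv_gword_closed[OF w]]])
  with Cons.IH[OF w] show ?case
    by (auto simp: inv_gword_def x intro: pres_eq.trans)
qed

lemma group_presented_group: "group (presented_group S rels)"
proof (rule groupI)
  let ?P = "presented_group S rels"
  have one: "\<one>\<^bsub>?P\<^esub> = pres_rel S rels `` {[]}"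
    by (simp add: presented_group_def)
  show "\<one>\<^bsub>?P\<^esub> \<in> carrier ?P"
    by (simp add: one presented_group_class_closed)
  show "x \<otimes>\<^bsub>?P\<^esub> y \<in> carrier ?P" if "x \<in> carrier ?P" "y \<in> carrier ?P" for x y
    using that by (elim presented_group_carrierE)
      (simp add: presented_group_mult presented_group_class_closed)
  show "x \<otimes>\<^bsub>?P\<^esub> y \<otimes>\<^bsub>?P\<^esub> z = x \<otimes>\<^bsub>?P\<^esub> (y \<otimes>\<^bsub>?P\<^esub> z)"
    if "x \<in> carrier ?P" "y \<in> carrier ?P" "z \<in> carrier ?P" for x y z
    using that by (elim presented_group_carrierE)
      (simp add: presented_group_mult)
  show "\<one>\<^bsub>?P\<^esub> \<otimes>\<^bsub>?P\<^esub> x = x" if "x \<in> carrier ?P" for x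
    using that by (elim presented_group_carrierE)
      (simp add: one presented_group_mult)
  show "\<exists>y\<in>carrier ?P. y \<otimes>\<^bsub>?P\<^esub> x = \<one>\<^bsub>?P\<^esub>" if x: "x \<in> carrier ?P" for x
  proof -
    obtain w where w: "w \<in> gwords S" "x = pres_rel S rels `` {w}"
      using x by (rule presented_group_carrierE)
    show ?thesis
    proof (rule bexI)
      show "pres_rel S rels `` {inv_gword w} \<otimes>\<^bsub>?P\<^esub> x = \<one>\<^bsub>?P\<^esub>"
        unfolding w(2) one presented_group_mult[OF inv_gword_closed[OF w(1)] w(1)]
        using inv_gword_closed[OF w(1)] w(1)
        by (subst pres_class_eq_iff) (auto simp: inv_gword_cancel)
      show "pres_rel S rels `` {inv_gword w} \<in> carrier ?P"
        by (rule presented_group_class_closed[OF inv_gword_closed[OF w(1)]])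
    qed
  qed
qed

text \<open>The universal property of the presentation.\<close>

definition eval_gword :: "('b, 'c) monoid_scheme \<Rightarrow> ('a \<Rightarrow> 'b) \<Rightarrow> 'a gword \<Rightarrow> 'b"
  where "eval_gword H f w =
    foldr (\<lambda>(s, b) x. (if b then f s else inv\<^bsub>H\<^esub> (f s)) \<otimes>\<^bsub>H\<^esub> x) w \<one>\<^bsub>H\<^esub>"

context group
begin

lemma eval_gword_closed:
  "f \<in> S \<rightarrow> carrier G \<Longrightarrow> w \<in> gwords S \<Longrightarrow> eval_gword G f w \<in> carrier G"
proof (induction w)
  case (Cons x w)
  obtain s b where x: "x = (s, b)" by (cases x)
  have "s \<in> S" and w: "w \<in> gwords S"
    using Cons.prems x by simp_all
  then have s: "f s \<in> carrier G"
    using Cons.prems(1) by blast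
  have "eval_gword G f (x # w) = (if b then f s else inv (f s)) \<otimes> eval_gword G f w"
    by (simp add: eval_gword_def x)
  with s Cons.IH[OF Cons.prems(1) w] show ?case by simp
qed (simp add: eval_gword_def)

lemma eval_gword_append:
  "f \<in> S \<rightarrow> carrier G \<Longrightarrow> u \<in> gwords S \<Longrightarrow> v \<in> gwords S \<Longrightarrow>
    eval_gword G f (u @ v) = eval_gword G f u \<otimes> eval_gword G f v"
proof (induction u)
  case Nil
  then show ?case using eval_gword_closed[of f S v] by (simp add: eval_gword_def)
next
  case (Cons x u)
  obtain s b where x: "x = (s, b)" by (cases x)
  have s: "s \<in> S" and u: "u \<in> gwords S"
    using Cons.prems x by simp_all
  let ?g = "if b then f s else inv (f s)"
  have cons: "eval_gword G f (x # w) = ?g \<otimes> eval_gword G f w" for w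
    by (simp add: eval_gword_def x)
  have "?g \<in> carrier G"
    using funcset_mem[OF Cons.prems(1) s] by simp
  then show ?case
    using Cons.IH[OF Cons.prems(1) u Cons.prems(3)] eval_gword_closed[OF Cons.prems(1) u]
      eval_gword_closed[OF Cons.prems(1,3)]
    by (simp add: cons m_assoc)
qed

lemma eval_gword_pres_eq:
  assumes f: "f \<in> S \<rightarrow> carrier G"
    and rels: "\<And>u v. (u, v) \<in> rels \<Longrightarrow> u \<in> gwords S \<Longrightarrow> v \<in> gwords S \<Longrightarrow>
      eval_gword G f u = eval_gword G f v"
    and "pres_eq S rels u v"
  shows "eval_gword G f u = eval_gword G f v"
  using assms(3)
proof (induction rule: pres_eq.induct)
  case (append u u' v v')
  then show ?case
    using pres_eq_gwords[of S rels u u'] pres_eq_gwords[of S rels v v']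
    by (simp add: eval_gword_append[OF f])
next
  case (cancel s b)
  then have "f s \<in> carrier G" using f by auto
  then show ?case by (simp add: eval_gword_def)
qed (use rels in auto)

lemma presented_group_hom:
  assumes f: "f \<in> S \<rightarrow> carrier G"
    and rels: "\<And>u v. (u, v) \<in> rels \<Longrightarrow> u \<in> gwords S \<Longrightarrow> v \<in> gwords S \<Longrightarrow>
      eval_gword G f u = eval_gword G f v"
  shows "\<exists>h \<in> hom (presented_group S rels) G.
    \<forall>w\<in>gwords S. h (pres_rel S rels `` {w}) = eval_gword G f w"
proof -
  define h where "h A = eval_gword G f (SOME w. w \<in> A)" for A
  have h: "h (pres_rel S rels `` {w}) = eval_gword G f w" if "w \<in> gwords S" for w
  proof -
    have "w \<in> pres_rel S rels `` {w}"
      using that by (auto simp: pres_rel_def intro: pres_eq.refl)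
    then have "(SOME v. v \<in> pres_rel S rels `` {w}) \<in> pres_rel S rels `` {w}"
      by (rule someI)
    then show ?thesis
      unfolding h_def using eval_gword_pres_eq[OF f rels] by (auto simp: pres_rel_def)
  qed
  have "h \<in> hom (presented_group S rels) G"
  proof (rule homI)
    fix x y
    assume "x \<in> carrier (presented_group S rels)" "y \<in> carrier (presented_group S rels)"
    then obtain u v where uv: "u \<in> gwords S" "v \<in> gwords S"
      and xy: "x = pres_rel S rels `` {u}" "y = pres_rel S rels `` {v}"
      by (elim presented_group_carrierE)
    have "u @ v \<in> gwords S" using uv by auto
    then show "h (x \<otimes>\<^bsub>presented_group S rels\<^esub> y) = h x \<otimes> h y"
      using uv by (simp add: xy presented_group_mult h eval_gword_append[OF f])
  next
    fix x
    assume "x \<in> carrier (presented_group S rels)"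
    then show "h x \<in> carrier G"
      by (elim presented_group_carrierE) (simp add: h eval_gword_closed[OF f])
  qed
  with h show ?thesis by blast
qed

end

section \<open>The quotient of the braid group\<close>

abbreviation gen :: "'a \<Rightarrow> 'a \<times> bool"
  where "gen i \<equiv> (i, True)"

definition braid_relations :: "nat \<Rightarrow> (nat gword \<times> nat gword) set"
  where "braid_relations n =
    {([gen i, gen (i + 1), gen i], [gen (i + 1), gen i, gen (i + 1)]) | i. 1 \<le> i \<and> i \<le> n - 2} \<union>
    {([gen i, gen j], [gen j, gen i]) | i j.
      i \<in> {1..n - 1} \<and> j \<in> {1..n - 1} \<and> \<bar>int i - int j\<bar> \<ge> 2}"

definition braid_quotient :: "nat \<Rightarrow> nat gword set monoid"
  where "braid_quotient n = presented_group {1..n - 1}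
    (braid_relations n \<union> {([gen 1, gen 1], [gen 2, gen 1, gen 1, gen 2])})"

section \<open>The rotational hyperoctahedral group\<close>

definition special_orthogonal_group :: "nat \<Rightarrow> real mat monoid"
  where "special_orthogonal_group n =
    \<lparr>carrier = {A \<in> carrier_mat n n. A\<^sup>T * A = 1\<^sub>m n \<and> det A = 1},
     monoid.mult = (*),
     one = 1\<^sub>m n\<rparr>"

text \<open>The basis vectors are indexed by \<open>0, \<dots>, n - 1\<close>.\<close>

definition hyperoctahedron_vertices :: "nat \<Rightarrow> real vec set"
  where "hyperoctahedron_vertices n = (\<Union>i<n. {unit_vec n i, - unit_vec n i})"

definition rot_hyperoctahedral_group :: "nat \<Rightarrow> real mat monoid"
  where "rot_hyperoctahedral_group n = (special_orthogonal_group n)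
    \<lparr>carrier := {A \<in> carrier (special_orthogonal_group n).
      bij_betw (\<lambda>v. A *\<^sub>v v) (hyperoctahedron_vertices n) (hyperoctahedron_vertices n)}\<rparr>"

lemma group_special_orthogonal_group: "group (special_orthogonal_group n)"
proof (rule groupI)
  let ?SO = "special_orthogonal_group n"
  show "\<one>\<^bsub>?SO\<^esub> \<in> carrier ?SO"
    by (simp add: special_orthogonal_group_def)
  show "A \<otimes>\<^bsub>?SO\<^esub> B \<in> carrier ?SO" if A: "A \<in> carrier ?SO" and B: "B \<in> carrier ?SO" for A B
  proof -
    have c: "A \<in> carrier_mat n n" "B \<in> carrier_mat n n"
      using A B by (auto simp: special_orthogonal_group_def)
    have "(A * B)\<^sup>T * (A * B) = B\<^sup>T * (A\<^sup>T * A) * B"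
      using c by (simp add: transpose_mult[OF c] assoc_mult_mat[of _ n n _ n _ n])
    also have "\<dots> = 1\<^sub>m n"
      using A B c by (simp add: special_orthogonal_group_def)
    finally show ?thesis
      using A B c by (simp add: special_orthogonal_group_def det_mult[OF c])
  qed
  show "A \<otimes>\<^bsub>?SO\<^esub> B \<otimes>\<^bsub>?SO\<^esub> C = A \<otimes>\<^bsub>?SO\<^esub> (B \<otimes>\<^bsub>?SO\<^esub> C)"
    if "A \<in> carrier ?SO" "B \<in> carrier ?SO" "C \<in> carrier ?SO" for A B C
    using that by (auto simp: special_orthogonal_group_def assoc_mult_mat[of _ n n _ n _ n])
  show "\<one>\<^bsub>?SO\<^esub> \<otimes>\<^bsub>?SO\<^esub> A = A" if "A \<in> carrier ?SO" for A
    using that by (auto simp: special_orthogonal_group_def)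
  show "\<exists>B\<in>carrier ?SO. B \<otimes>\<^bsub>?SO\<^esub> A = \<one>\<^bsub>?SO\<^esub>" if A: "A \<in> carrier ?SO" for A
  proof
    have c: "A \<in> carrier_mat n n" "A\<^sup>T * A = 1\<^sub>m n" "det A = 1"
      using A by (auto simp: special_orthogonal_group_def)
    then show "A\<^sup>T \<otimes>\<^bsub>?SO\<^esub> A = \<one>\<^bsub>?SO\<^esub>"
      by (simp add: special_orthogonal_group_def)
    have "A * A\<^sup>T = 1\<^sub>m n"
      using mat_mult_left_right_inverse[of "A\<^sup>T" n A] c by simp
    then show "A\<^sup>T \<in> carrier ?SO"
      using c by (simp add: special_orthogonal_group_def det_transpose)
  qed
qed

lemma hyperoctahedron_vertices_carrier: "hyperoctahedron_vertices n \<subseteq> carrier_vec n"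
  by (auto simp: hyperoctahedron_vertices_def)

lemma subgroup_rot_hyperoctahedral_group:
  "subgroup (carrier (rot_hyperoctahedral_group n)) (special_orthogonal_group n)"
proof -
  interpret SO: group "special_orthogonal_group n"
    by (rule group_special_orthogonal_group)
  let ?SO = "special_orthogonal_group n" and ?V = "hyperoctahedron_vertices n"
  have act: "bij_betw (\<lambda>v. (A * B) *\<^sub>v v) ?V ?V \<longleftrightarrow> bij_betw ((\<lambda>v. A *\<^sub>v v) \<circ> (\<lambda>v. B *\<^sub>v v)) ?V ?V"
    if "A \<in> carrier ?SO" "B \<in> carrier ?SO" for A B
    using that hyperoctahedron_vertices_carrier[of n]
    by (intro bij_betw_cong) (auto simp: special_orthogonal_group_def intro!: assoc_mult_mat_vec)
  have one: "bij_betw (\<lambda>v. 1\<^sub>m n *\<^sub>v v) ?V ?V"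
    using hyperoctahedron_vertices_carrier[of n]
    by (subst bij_betw_cong[where g = id]) auto
  show ?thesis
  proof (rule SO.subgroupI)
    show "carrier (rot_hyperoctahedral_group n) \<subseteq> carrier ?SO"
      by (auto simp: rot_hyperoctahedral_group_def)
    have "1\<^sub>m n \<in> carrier (rot_hyperoctahedral_group n)"
      using one SO.one_closed
      by (simp add: rot_hyperoctahedral_group_def special_orthogonal_group_def)
    then show "carrier (rot_hyperoctahedral_group n) \<noteq> {}" by auto
  next
    fix A B
    assume "A \<in> carrier (rot_hyperoctahedral_group n)" "B \<in> carrier (rot_hyperoctahedral_group n)"
    then show "A \<otimes>\<^bsub>?SO\<^esub> B \<in> carrier (rot_hyperoctahedral_group n)"
      using SO.m_closed[of A B] act[of A B]
      by (auto simp: rot_hyperoctahedral_group_def special_orthogonal_group_def intro: bij_betw_trans)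
  next
    fix A
    assume A: "A \<in> carrier (rot_hyperoctahedral_group n)"
    then have ASO: "A \<in> carrier ?SO" and bA: "bij_betw (\<lambda>v. A *\<^sub>v v) ?V ?V"
      by (auto simp: rot_hyperoctahedral_group_def)
    let ?B = "inv\<^bsub>?SO\<^esub> A"
    have BSO: "?B \<in> carrier ?SO" using ASO by simp
    have "?B * A = 1\<^sub>m n"
      using SO.l_inv[OF ASO] by (simp add: special_orthogonal_group_def)
    then have "bij_betw ((\<lambda>v. ?B *\<^sub>v v) \<circ> (\<lambda>v. A *\<^sub>v v)) ?V ?V"
      using act[OF BSO ASO] one by simp
    then have "bij_betw (\<lambda>v. ?B *\<^sub>v v) ?V ?V"
      using bij_betw_comp_iff[OF bA] by blast
    with BSO show "?B \<in> carrier (rot_hyperoctahedral_group n)"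
      by (simp add: rot_hyperoctahedral_group_def)
  qed
qed

lemma group_rot_hyperoctahedral_group: "group (rot_hyperoctahedral_group n)"
  using group.subgroup_imp_group[OF group_special_orthogonal_group subgroup_rot_hyperoctahedral_group]
  by (simp add: rot_hyperoctahedral_group_def)

section \<open>Central extensions\<close>

text \<open>
  The predicate \<open>short_exact_sequence\<close> of HOL-Algebra requires the three groups to have the same
  element type, hence the following version of it.
\<close>

definition group_extension ::
    "('a, 'k) monoid_scheme \<Rightarrow> ('b, 'l) monoid_scheme \<Rightarrow> ('c, 'm) monoid_scheme \<Rightarrow>
      ('a \<Rightarrow> 'b) \<Rightarrow> ('b \<Rightarrow> 'c) \<Rightarrow> bool"
  where "group_extension K E Q \<iota> \<pi> \<longleftrightarrow>
    group K \<and> group E \<and> group Q \<and> \<iota> \<in> mon K E \<and> \<pi> \<in> epi E Q \<and> \<iota> ` carrier K = kernel E Q \<pi>"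

definition central_extension ::
    "('a, 'k) monoid_scheme \<Rightarrow> ('b, 'l) monoid_scheme \<Rightarrow> ('c, 'm) monoid_scheme \<Rightarrow>
      ('a \<Rightarrow> 'b) \<Rightarrow> ('b \<Rightarrow> 'c) \<Rightarrow> bool"
  where "central_extension K E Q \<iota> \<pi> \<longleftrightarrow> group_extension K E Q \<iota> \<pi> \<and>
    (\<forall>x\<in>carrier K. \<forall>y\<in>carrier E. \<iota> x \<otimes>\<^bsub>E\<^esub> y = y \<otimes>\<^bsub>E\<^esub> \<iota> x)"

text \<open>
  An extension splits iff the projection has a section that is a homomorphism, that is, iff it is
  a semidirect product.
\<close>

definition extension_splits ::
    "('b, 'l) monoid_scheme \<Rightarrow> ('c, 'm) monoid_scheme \<Rightarrow> ('b \<Rightarrow> 'c) \<Rightarrow> bool"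
  where "extension_splits E Q \<pi> \<longleftrightarrow> (\<exists>\<sigma>\<in>hom Q E. \<forall>q\<in>carrier Q. \<pi> (\<sigma> q) = q)"

end

theory Submission
  imports Defs "HOL-Algebra.Bij"
begin

text \<open>
  Write \<open>a\<^sub>i = R\<^sub>i\<^sup>2\<close> and \<open>z = R\<^sub>1\<^sup>4\<close>. The model to keep in mind is the spin group: there \<open>R\<^sub>i\<close> is
  \<open>(1 + e\<^sub>i e\<^sub>i\<^sub>+\<^sub>1) / \<surd>2\<close>, which covers the rotation by a quarter turn in the plane of \<open>e\<^sub>i\<close> and
  \<open>e\<^sub>i\<^sub>+\<^sub>1\<close>, and \<open>z\<close> is \<open>- 1\<close>. Three facts make this model faithful.

  Upper bound. Conjugation inside the braid group carries the single relation
  \<open>R\<^sub>1\<^sup>2 = R\<^sub>2 R\<^sub>1\<^sup>2 R\<^sub>2\<close> to all pairs of neighbouring generators, in both orders (\<open>lower_square\<close>,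
  \<open>upper_square\<close>). Hence neighbouring \<open>a\<^sub>i\<close> invert each other, all \<open>R\<^sub>i\<^sup>4\<close> are equal to \<open>z\<close>, and
  \<open>z\<close> is central with \<open>z\<^sup>2 = 1\<close>. Let \<open>S\<^sub>k\<close> be the subgroup generated by \<open>z, R\<^sub>1, \<dots>, R\<^sub>k\<close>. A coset
  enumeration (\<open>tower_subset_coset_union\<close>) writes \<open>S\<^sub>k\<^sub>+\<^sub>1\<close> as a union of \<open>2 (k + 2)\<close> cosets of
  \<open>S\<^sub>k\<close>, with representatives \<open>R\<^sub>j R\<^sub>j\<^sub>+\<^sub>1 \<dots> R\<^sub>k\<^sub>+\<^sub>1\<close>, possibly followed by \<open>a\<^sub>k\<^sub>+\<^sub>1\<close>.

  Comparison with the rotations. Sending \<open>R\<^sub>i\<close> to the quarter turn defines a homomorphism \<open>\<pi>\<close>.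
  The \<open>2 (k + 2)\<close> representatives move one basis vector to the \<open>2 (k + 2)\<close> different vertices of
  a hyperoctahedron of dimension \<open>k + 2\<close>. So the cosets are disjoint, and an element of
  \<open>S\<^sub>k\<^sub>+\<^sub>1\<close> that fixes this vector lies in \<open>S\<^sub>k\<close>. Descending from \<open>S\<^sub>n\<^sub>-\<^sub>1\<close>, which is the whole
  group, to \<open>S\<^sub>0 = {1, z}\<close> gives the kernel of \<open>\<pi>\<close> (\<open>kernel_in_tower\<close>) and, if \<open>z \<noteq> 1\<close>, the
  order \<open>2 \<cdot> 4 \<cdot> 6 \<cdots> 2n = 2\<^sup>n n!\<close> (\<open>card_tower\<close>). Transitivity on the vertices gives
  surjectivity (\<open>pi_surj\<close>): correct a rotation by elements of the image until it fixes all basis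
  vectors but one; the determinant then forces it to be the identity.

  Nontriviality. The elements \<open>e\<^sub>i e\<^sub>i\<^sub>+\<^sub>1\<close> of the model are realised by operators on a function
  space, and there \<open>z\<close> acts as \<open>- 1\<close>, so \<open>z \<noteq> 1\<close> (\<open>z_neq_one\<close>). A section of \<open>\<pi>\<close> would send a
  quarter turn, whose fourth power is \<open>1\<close>, to \<open>R\<^sub>1\<close> or \<open>R\<^sub>1 z\<close>, both of which have fourth power
  \<open>z\<close>; so there is none.
\<close>

section \<open>Squares of the braid generators\<close>

context group
begin

lemma conj_mult:
  assumes "c \<in> carrier G" "x \<in> carrier G" "y \<in> carrier G" "x' \<in> carrier G" "y' \<in> carrier G"
    and "c \<otimes> x = x' \<otimes> c" "c \<otimes> y = y' \<otimes> c"
  shows "c \<otimes> (x \<otimes> y) = (x' \<otimes> y') \<otimes> c"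
proof -
  have "c \<otimes> (x \<otimes> y) = x' \<otimes> (c \<otimes> y)"
    using assms(1-6) by (metis m_assoc)
  then show ?thesis using assms by (simp add: m_assoc)
qed

lemma conj_inv:
  assumes cl: "c \<in> carrier G" "x \<in> carrier G" "x' \<in> carrier G" and x: "c \<otimes> x = x' \<otimes> c"
  shows "c \<otimes> inv x = inv x' \<otimes> c"
proof -
  have "c \<otimes> inv x = inv x' \<otimes> ((x' \<otimes> c) \<otimes> inv x)"
    using cl by (simp add: m_assoc flip: m_assoc[of "inv x'" x'])
  also have "\<dots> = inv x' \<otimes> c"
    using cl by (simp add: m_assoc flip: x)
  finally show ?thesis .
qed

text \<open>Transports the additional relation along a conjugation.\<close>

lemma square_relation_conj:
  assumes c: "c \<in> carrier G" "x \<in> carrier G" "y \<in> carrier G" "x' \<in> carrier G" "y' \<in> carrier G"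
    and x: "c \<otimes> x = x' \<otimes> c" and y: "c \<otimes> y = y' \<otimes> c"
    and rel: "y \<otimes> ((x \<otimes> x) \<otimes> y) = x \<otimes> x"
  shows "y' \<otimes> ((x' \<otimes> x') \<otimes> y') = x' \<otimes> x'"
proof -
  have xx: "c \<otimes> (x \<otimes> x) = (x' \<otimes> x') \<otimes> c"
    by (rule conj_mult[OF _ _ _ _ _ x x]) (use c in auto)
  have "c \<otimes> ((x \<otimes> x) \<otimes> y) = ((x' \<otimes> x') \<otimes> y') \<otimes> c"
    by (rule conj_mult[OF _ _ _ _ _ xx y]) (use c in auto)
  from conj_mult[OF _ _ _ _ _ y this]
  have "c \<otimes> (y \<otimes> ((x \<otimes> x) \<otimes> y)) = (y' \<otimes> ((x' \<otimes> x') \<otimes> y')) \<otimes> c"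
    using c by auto
  with xx rel have "(y' \<otimes> ((x' \<otimes> x') \<otimes> y')) \<otimes> c = (x' \<otimes> x') \<otimes> c" by simp
  then show ?thesis using c by simp
qed

text \<open>In the braid group on four strands, conjugation by \<open>x y w\<close> shifts the generators by one.\<close>

lemma braid_conj_shift:
  assumes cl: "x \<in> carrier G" "y \<in> carrier G" "w \<in> carrier G"
    and b1: "x \<otimes> (y \<otimes> x) = y \<otimes> (x \<otimes> y)" and b2: "y \<otimes> (w \<otimes> y) = w \<otimes> (y \<otimes> w)"
    and f: "x \<otimes> w = w \<otimes> x"
  shows "(x \<otimes> (y \<otimes> w)) \<otimes> x = y \<otimes> (x \<otimes> (y \<otimes> w))"
    and "(x \<otimes> (y \<otimes> w)) \<otimes> y = w \<otimes> (x \<otimes> (y \<otimes> w))"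
proof -
  have "(x \<otimes> (y \<otimes> w)) \<otimes> x = (x \<otimes> (y \<otimes> x)) \<otimes> w" using cl by (simp add: m_assoc flip: f)
  also have "\<dots> = y \<otimes> (x \<otimes> (y \<otimes> w))" using cl by (simp add: m_assoc b1)
  finally show "(x \<otimes> (y \<otimes> w)) \<otimes> x = y \<otimes> (x \<otimes> (y \<otimes> w))" .
  have "(x \<otimes> (y \<otimes> w)) \<otimes> y = (x \<otimes> w) \<otimes> (y \<otimes> w)" using cl by (simp add: m_assoc b2)
  also have "\<dots> = w \<otimes> (x \<otimes> (y \<otimes> w))" using cl by (simp add: f m_assoc)
  finally show "(x \<otimes> (y \<otimes> w)) \<otimes> y = w \<otimes> (x \<otimes> (y \<otimes> w))" .
qed

text \<open>The hypotheses say that conjugation by each element inverts the other, as for \<open>i\<close> and \<open>j\<close> in the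
  quaternion group. Multiplying \<open>a b a = b\<close> by \<open>b\<close> on the right and using \<open>b a b = a\<close> gives \<open>b\<^sup>2 = a\<^sup>2\<close>;
  squaring \<open>a b a = b\<close> then gives \<open>a\<^sup>2 = a\<^sup>6\<close>.\<close>

lemma mutually_inverting_elements:
  assumes ab: "a \<in> carrier G" "b \<in> carrier G"
    and aba: "a \<otimes> (b \<otimes> a) = b" and bab: "b \<otimes> (a \<otimes> b) = a"
  shows "b \<otimes> b = a \<otimes> a" and "(a \<otimes> a) \<otimes> (a \<otimes> a) = \<one>"
proof -
  have "b \<otimes> b = (a \<otimes> (b \<otimes> a)) \<otimes> b" using aba by simp
  also have "\<dots> = a \<otimes> (b \<otimes> (a \<otimes> b))" using ab by (simp add: m_assoc)
  finally show bb: "b \<otimes> b = a \<otimes> a" using bab by simp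
  have bb': "b \<otimes> (b \<otimes> t) = a \<otimes> (a \<otimes> t)" if "t \<in> carrier G" for t
    using bb ab that by (metis m_assoc)
  have "a \<otimes> a = (a \<otimes> (b \<otimes> a)) \<otimes> (a \<otimes> (b \<otimes> a))" using aba bb by simp
  also have "\<dots> = a \<otimes> (b \<otimes> ((a \<otimes> a) \<otimes> (b \<otimes> a)))" using ab by (simp add: m_assoc)
  also have "\<dots> = a \<otimes> (b \<otimes> (b \<otimes> (b \<otimes> (b \<otimes> a))))" using ab by (simp add: m_assoc flip: bb)
  also have "\<dots> = (a \<otimes> a) \<otimes> ((a \<otimes> a) \<otimes> (a \<otimes> a))" using ab by (simp add: bb' m_assoc)
  finally show "(a \<otimes> a) \<otimes> (a \<otimes> a) = \<one>"
    using ab by (metis m_closed l_cancel_one)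
qed

end

text \<open>Elements of any group that satisfy the defining relations, with products associated to the right.\<close>

locale braid_quotient_elements = group G for G (structure) +
  fixes r :: "nat \<Rightarrow> 'a" and n :: nat
  assumes n_ge: "3 \<le> n"
    and r_closed: "1 \<le> i \<Longrightarrow> i < n \<Longrightarrow> r i \<in> carrier G"
    and braid: "1 \<le> i \<Longrightarrow> Suc i < n \<Longrightarrow>
      r i \<otimes> (r (Suc i) \<otimes> r i) = r (Suc i) \<otimes> (r i \<otimes> r (Suc i))"
    and far_commute: "1 \<le> i \<Longrightarrow> i + 2 \<le> j \<Longrightarrow> j < n \<Longrightarrow> r i \<otimes> r j = r j \<otimes> r i"
    and first_square: "r 1 \<otimes> r 1 = r 2 \<otimes> ((r 1 \<otimes> r 1) \<otimes> r 2)"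
begin

definition a :: "nat \<Rightarrow> 'a" where "a i = r i \<otimes> r i"

definition z :: 'a where "z = a 1 \<otimes> a 1"

lemma a_closed: "1 \<le> i \<Longrightarrow> i < n \<Longrightarrow> a i \<in> carrier G"
  by (simp add: a_def r_closed)

lemma z_closed: "z \<in> carrier G"
  using n_ge by (simp add: z_def a_closed)

lemma conj_shift:
  assumes "1 \<le> i" "i + 2 < n"
  defines "c \<equiv> r i \<otimes> (r (i + 1) \<otimes> r (i + 2))"
  shows "c \<otimes> r i = r (i + 1) \<otimes> c" "c \<otimes> r (i + 1) = r (i + 2) \<otimes> c"
  unfolding c_def
  using assms(1,2) braid[of i] braid[of "i + 1"] far_commute[of i "i + 2"]
  by (auto intro!: braid_conj_shift r_closed)

text \<open>Induction on \<open>i\<close>: conjugation by \<open>R\<^sub>i R\<^sub>i\<^sub>+\<^sub>1 R\<^sub>i\<^sub>+\<^sub>2\<close> takes the relation for \<open>i\<close> to the one for \<open>i + 1\<close>.\<close>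

lemma lower_square: "1 \<le> i \<Longrightarrow> i + 1 < n \<Longrightarrow> r (i + 1) \<otimes> (a i \<otimes> r (i + 1)) = a i"
proof (induction i rule: nat_induct_at_least)
  case base
  then show ?case using first_square by (simp add: a_def numeral_2_eq_2)
next
  case (Suc i)
  then have cl: "r i \<in> carrier G" "r (i + 1) \<in> carrier G" "r (i + 2) \<in> carrier G"
    by (auto intro: r_closed)
  have "r (i + 2) \<otimes> ((r (i + 1) \<otimes> r (i + 1)) \<otimes> r (i + 2)) = r (i + 1) \<otimes> r (i + 1)"
    by (rule square_relation_conj[OF _ _ _ _ _ conj_shift])
      (use Suc cl in \<open>auto simp: a_def\<close>)
  then show ?case by (simp add: a_def)
qed

text \<open>The half twist \<open>R\<^sub>i R\<^sub>i\<^sub>+\<^sub>1 R\<^sub>i\<close> interchanges \<open>R\<^sub>i\<close> and \<open>R\<^sub>i\<^sub>+\<^sub>1\<close>, and so turns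
  \<open>lower_square\<close> into the present relation.\<close>

lemma upper_square:
  assumes "1 \<le> i" "i + 1 < n"
  shows "r i \<otimes> (a (i + 1) \<otimes> r i) = a (i + 1)"
proof -
  let ?x = "r i" and ?y = "r (i + 1)"
  have cl: "?x \<in> carrier G" "?y \<in> carrier G"
    using assms by (auto intro: r_closed)
  have b: "?x \<otimes> (?y \<otimes> ?x) = ?y \<otimes> (?x \<otimes> ?y)"
    using braid[of i] assms by simp
  have "(?x \<otimes> (?y \<otimes> ?x)) \<otimes> ?x = (?y \<otimes> (?x \<otimes> ?y)) \<otimes> ?x" by (simp only: b)
  then have x: "(?x \<otimes> (?y \<otimes> ?x)) \<otimes> ?x = ?y \<otimes> (?x \<otimes> (?y \<otimes> ?x))"
    using cl by (simp add: m_assoc)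
  have "(?x \<otimes> (?y \<otimes> ?x)) \<otimes> ?y = ?x \<otimes> (?y \<otimes> (?x \<otimes> ?y))"
    using cl by (simp add: m_assoc)
  then have y: "(?x \<otimes> (?y \<otimes> ?x)) \<otimes> ?y = ?x \<otimes> (?x \<otimes> (?y \<otimes> ?x))"
    by (simp only: b)
  show ?thesis unfolding a_def
    by (rule square_relation_conj[OF _ _ _ _ _ x y])
      (use cl lower_square[OF assms] in \<open>auto simp: a_def\<close>)
qed

lemma a_inverts:
  assumes "1 \<le> i" "i + 1 < n"
  shows "a (i + 1) \<otimes> (a i \<otimes> a (i + 1)) = a i" "a i \<otimes> (a (i + 1) \<otimes> a i) = a (i + 1)"
proof -
  have cl: "r i \<in> carrier G" "r (i + 1) \<in> carrier G" "a i \<in> carrier G" "a (i + 1) \<in> carrier G"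
    using assms by (auto intro: r_closed a_closed)
  have "a (i + 1) \<otimes> (a i \<otimes> a (i + 1)) =
      r (i + 1) \<otimes> ((r (i + 1) \<otimes> (a i \<otimes> r (i + 1))) \<otimes> r (i + 1))"
    using cl by (simp add: a_def[of "Suc i"] m_assoc)
  then show "a (i + 1) \<otimes> (a i \<otimes> a (i + 1)) = a i" by (simp only: lower_square[OF assms])
  have "a i \<otimes> (a (i + 1) \<otimes> a i) = r i \<otimes> ((r i \<otimes> (a (i + 1) \<otimes> r i)) \<otimes> r i)"
    using cl by (simp add: a_def[of i] m_assoc)
  then show "a i \<otimes> (a (i + 1) \<otimes> a i) = a (i + 1)" by (simp only: upper_square[OF assms])
qed

lemma a_square: "1 \<le> i \<Longrightarrow> i < n \<Longrightarrow> a i \<otimes> a i = z"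
proof (induction i rule: nat_induct_at_least)
  case (Suc i)
  then show ?case
    using mutually_inverting_elements(1)[OF _ _ a_inverts(2,1)[of i]] by (simp add: a_closed)
qed (simp add: z_def)

text \<open>Needs two neighbouring generators, hence \<open>n \<ge> 3\<close>.\<close>

lemma z_square: "z \<otimes> z = \<one>"
  using mutually_inverting_elements(2)[OF _ _ a_inverts(2,1)[of 1]] n_ge
  by (simp add: a_closed z_def)

text \<open>\<open>z = R\<^sub>i\<^sup>4\<close> for every \<open>i\<close>.\<close>

lemma z_commute: "1 \<le> i \<Longrightarrow> i < n \<Longrightarrow> z \<otimes> r i = r i \<otimes> z"
  using a_square[of i] by (metis a_def m_assoc r_closed a_closed)

lemma far_commute': "\<lbrakk>1 \<le> i; i < n; 1 \<le> j; j < n; i + 2 \<le> j \<or> j + 2 \<le> i\<rbrakk> \<Longrightarrow> r i \<otimes> r j = r j \<otimes> r i"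
  using far_commute[of i j] far_commute[of j i] by auto

lemma a_far_commute:
  assumes "1 \<le> i" "i < n" "1 \<le> j" "j < n" "i + 2 \<le> j \<or> j + 2 \<le> i"
  shows "r i \<otimes> a j = a j \<otimes> r i"
  unfolding a_def using assms by (intro conj_mult) (auto intro: r_closed far_commute')

lemma a_past_r:
  assumes "1 \<le> i" "i + 1 < n"
  shows "a i \<otimes> r (i + 1) = r (i + 1) \<otimes> (a (i + 1) \<otimes> (z \<otimes> a i))"
proof -
  have cl: "r (i + 1) \<in> carrier G" "a i \<in> carrier G" "a (i + 1) \<in> carrier G"
    using assms by (auto intro: r_closed a_closed)
  have "r (i + 1) \<otimes> (a (i + 1) \<otimes> (z \<otimes> a i)) =
    r (i + 1) \<otimes> (a (i + 1) \<otimes> (z \<otimes> (r (i + 1) \<otimes> (a i \<otimes> r (i + 1)))))"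
    by (simp only: lower_square[OF assms])
  also have "\<dots> = r (i + 1) \<otimes> (a (i + 1) \<otimes> ((z \<otimes> r (i + 1)) \<otimes> (a i \<otimes> r (i + 1))))"
    using cl z_closed by (simp add: m_assoc)
  also have "\<dots> = a (i + 1) \<otimes> ((a (i + 1) \<otimes> z) \<otimes> (a i \<otimes> r (i + 1)))"
    using cl z_closed assms by (subst z_commute) (simp_all add: a_def m_assoc)
  also have "\<dots> = ((a (i + 1) \<otimes> a (i + 1)) \<otimes> z) \<otimes> (a i \<otimes> r (i + 1))"
    using cl z_closed by (simp add: m_assoc)
  also have "\<dots> = a i \<otimes> r (i + 1)"
    using assms cl by (simp add: a_square z_square)
  finally show ?thesis ..
qed

lemma inv_r: "1 \<le> i \<Longrightarrow> i < n \<Longrightarrow> inv (r i) = r i \<otimes> (r i \<otimes> (r i \<otimes> z))"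
proof -
  assume i: "1 \<le> i" "i < n"
  have cl: "r i \<in> carrier G" using i by (rule r_closed)
  have "r i \<otimes> (r i \<otimes> (r i \<otimes> (r i \<otimes> z))) = (a i \<otimes> a i) \<otimes> z"
    using cl z_closed by (simp add: a_def m_assoc)
  then have "(r i \<otimes> (r i \<otimes> (r i \<otimes> z))) \<otimes> r i = \<one>"
    using i cl z_closed by (simp add: a_square z_square m_assoc z_commute)
  then show ?thesis using cl z_closed by (intro inv_equality) auto
qed

lemma inv_z: "inv z = z"
  by (rule inv_equality) (simp_all add: z_square z_closed)

section \<open>Coset enumeration\<close>

text \<open>Including \<open>z\<close> among the generators makes the chain start at the kernel \<open>{1, z}\<close>, so that all its
  steps, the first one included, have the same form.\<close>

definition tower :: "nat \<Rightarrow> 'a set" where "tower k = generate G (insert z (r ` {1..k}))"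

lemma tower_generators: "k < n \<Longrightarrow> insert z (r ` {1..k}) \<subseteq> carrier G"
  by (auto intro: r_closed z_closed)

lemma subgroup_tower: "k < n \<Longrightarrow> subgroup (tower k) G"
  unfolding tower_def by (rule generate_is_subgroup[OF tower_generators])

lemma tower_closed: "k < n \<Longrightarrow> g \<in> tower k \<Longrightarrow> g \<in> carrier G"
  using subgroup.mem_carrier[OF subgroup_tower] .

lemma tower_mult: "k < n \<Longrightarrow> g \<in> tower k \<Longrightarrow> h \<in> tower k \<Longrightarrow> g \<otimes> h \<in> tower k"
  using subgroup.m_closed[OF subgroup_tower] .

lemma tower_one: "\<one> \<in> tower k"
  by (simp add: tower_def generate.one)

lemma z_in_tower: "z \<in> tower k"
  by (simp add: tower_def generate.incl)

lemma r_in_tower: "1 \<le> i \<Longrightarrow> i \<le> k \<Longrightarrow> r i \<in> tower k"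
  by (auto simp: tower_def intro: generate.incl)

lemma a_in_tower: "1 \<le> i \<Longrightarrow> i \<le> k \<Longrightarrow> k < n \<Longrightarrow> a i \<in> tower k"
  by (simp add: a_def tower_mult r_in_tower)

lemma tower_mono: "k \<le> l \<Longrightarrow> l < n \<Longrightarrow> tower k \<subseteq> tower l"
  unfolding tower_def by (rule mono_generate) auto

lemma tower_inv_mult: "k < n \<Longrightarrow> g \<in> tower k \<Longrightarrow> h \<in> tower k \<Longrightarrow> inv g \<otimes> h \<in> tower k"
  by (simp add: tower_mult subgroup.m_inv_closed[OF subgroup_tower])

lemma tower_0: "tower 0 = {\<one>, z}"
proof
  have "g = \<one> \<or> g = z" if "g \<in> tower 0" for g
    using that unfolding tower_def
    by (induction rule: generate.induct) (auto simp: inv_z z_square z_closed)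
  then show "tower 0 \<subseteq> {\<one>, z}" by auto
  show "{\<one>, z} \<subseteq> tower 0" by (simp add: tower_one z_in_tower)
qed

lemma z_central:
  assumes "k < n" "g \<in> tower k"
  shows "z \<otimes> g = g \<otimes> z"
  using assms(2) unfolding tower_def
proof (induction rule: generate.induct)
  case (incl h)
  then show ?case using assms(1) by (auto simp: z_commute)
next
  case (inv h)
  then show ?case
    using assms(1) tower_generators by (intro conj_inv z_closed) (auto simp: z_commute)
next
  case (eng g h)
  then have "g \<in> carrier G" "h \<in> carrier G" using tower_closed[OF assms(1)] by (auto simp: tower_def)
  then show ?case using eng.IH z_closed by (intro conj_mult) auto
qed (simp add: z_closed)

text \<open>In the model \<open>a\<^sub>k\<^sub>+\<^sub>1\<close> covers the half turn in the plane of \<open>e\<^sub>k\<^sub>+\<^sub>1\<close> and \<open>e\<^sub>k\<^sub>+\<^sub>2\<close>, which normalises the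
  stabiliser of \<open>e\<^sub>k\<^sub>+\<^sub>2\<close>. On generators: \<open>R\<^sub>i\<close> commutes with \<open>a\<^sub>k\<^sub>+\<^sub>1\<close> for \<open>i < k\<close>, and \<open>upper_square\<close> says
  that \<open>a\<^sub>k\<^sub>+\<^sub>1\<close> inverts \<open>R\<^sub>k\<close>.\<close>

lemma tower_normalised:
  assumes "Suc k < n" "h \<in> tower k"
  shows "\<exists>h'\<in>tower k. h \<otimes> a (Suc k) = a (Suc k) \<otimes> h'"
  using assms(2) unfolding tower_def
proof (induction rule: generate.induct)
  have cl: "a (Suc k) \<in> carrier G" using assms(1) by (simp add: a_closed)
  have gen: "\<exists>h'\<in>tower k. g \<otimes> a (Suc k) = a (Suc k) \<otimes> h'" if g: "g \<in> insert z (r ` {1..k})" for g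
  proof (cases "g = z")
    case True
    have "z \<otimes> a (Suc k) = a (Suc k) \<otimes> z"
      using assms(1) by (intro z_central[of "Suc k"] a_in_tower) auto
    with True z_in_tower show ?thesis by blast
  next
    case False
    with g obtain i where i: "g = r i" "1 \<le> i" "i \<le> k" by auto
    have ri: "r i \<in> carrier G" using i assms(1) by (simp add: r_closed)
    show ?thesis
    proof (cases "i = k")
      case True
      have "r k \<otimes> (a (Suc k) \<otimes> r k) = a (Suc k)"
        using upper_square[of k] True i assms(1) by simp
      then have "r k \<otimes> a (Suc k) = a (Suc k) \<otimes> inv (r k)"
        using cl ri True by (metis inv_solve_right m_assoc m_closed)
      moreover have "inv (r k) \<in> tower k"
        using True i assms(1) by (intro subgroup.m_inv_closed[OF subgroup_tower] r_in_tower) auto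
      ultimately show ?thesis using True i by blast
    next
      case False
      then have "r i \<otimes> a (Suc k) = a (Suc k) \<otimes> r i"
        using i assms(1) by (intro a_far_commute) auto
      then show ?thesis using i r_in_tower by blast
    qed
  qed
  {
    case one
    show ?case using cl generate.one by (intro bexI[of _ \<one>]) auto
  next
    case (incl g)
    then show ?case using gen tower_def by auto
  next
    case (inv g)
    then obtain g' where g': "g' \<in> tower k" "g \<otimes> a (Suc k) = a (Suc k) \<otimes> g'" using gen by auto
    have "g \<in> carrier G" "g' \<in> carrier G"
      using inv tower_generators[of k] g' tower_closed[of k] assms(1) by auto
    then have "inv g \<otimes> a (Suc k) = a (Suc k) \<otimes> inv g'"
      using g'(2) cl conj_inv[of "a (Suc k)" g' g] by simp
    moreover have "inv g' \<in> tower k" using g' assms(1) by (intro subgroup.m_inv_closed[OF subgroup_tower]) auto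
    ultimately show ?case using tower_def by auto
  next
    case (eng g h)
    then obtain g' h' where gh: "g' \<in> tower k" "h' \<in> tower k" "g \<otimes> a (Suc k) = a (Suc k) \<otimes> g'"
      "h \<otimes> a (Suc k) = a (Suc k) \<otimes> h'" unfolding tower_def by blast
    have cl': "g \<in> carrier G" "h \<in> carrier G" "g' \<in> carrier G" "h' \<in> carrier G"
      using eng gh tower_closed[of k] assms(1) by (auto simp: tower_def)
    have "(g \<otimes> h) \<otimes> a (Suc k) = (g \<otimes> a (Suc k)) \<otimes> h'"
      using cl cl' gh(4) by (simp add: m_assoc)
    also have "\<dots> = a (Suc k) \<otimes> (g' \<otimes> h')"
      using cl cl' gh(3) by (simp add: m_assoc)
    finally show ?case using tower_mult[of k g' h'] gh assms(1) unfolding tower_def by auto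
  }
qed

text \<open>In the model this is the stabiliser in \<open>S\<^sub>k\<^sub>+\<^sub>1\<close> of the line spanned by \<open>e\<^sub>k\<^sub>+\<^sub>2\<close>; the half turn
  \<open>a\<^sub>k\<^sub>+\<^sub>1\<close> reverses the direction.\<close>

definition axis_stab :: "nat \<Rightarrow> 'a set" where "axis_stab k = tower k \<union> (\<lambda>h. a (Suc k) \<otimes> h) ` tower k"

lemma axis_stab_closed: "Suc k < n \<Longrightarrow> t \<in> axis_stab k \<Longrightarrow> t \<in> carrier G"
  using a_closed[of "Suc k"] tower_closed[of k] by (auto simp: axis_stab_def)

lemma tower_axis_stab:
  assumes "Suc k < n" "h \<in> tower k" "t \<in> axis_stab k"
  shows "h \<otimes> t \<in> axis_stab k"
proof (cases "t \<in> tower k")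
  case True
  then show ?thesis using assms by (simp add: axis_stab_def tower_mult)
next
  case False
  then obtain g where g: "g \<in> tower k" "t = a (Suc k) \<otimes> g" using assms by (auto simp: axis_stab_def)
  obtain h' where h': "h' \<in> tower k" "h \<otimes> a (Suc k) = a (Suc k) \<otimes> h'"
    using tower_normalised assms by blast
  have "h \<otimes> t = (h \<otimes> a (Suc k)) \<otimes> g"
    using assms g tower_closed[of k] a_closed[of "Suc k"] by (simp add: m_assoc)
  also have "\<dots> = a (Suc k) \<otimes> (h' \<otimes> g)"
    using assms g h' tower_closed[of k] a_closed[of "Suc k"] by (simp add: m_assoc)
  finally show ?thesis using tower_mult[of k h' g] assms g h' by (auto simp: axis_stab_def)
qed

lemma a_axis_stab:
  assumes "Suc k < n" "t \<in> axis_stab k"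
  shows "a (Suc k) \<otimes> t \<in> axis_stab k"
proof (cases "t \<in> tower k")
  case False
  then obtain g where g: "g \<in> tower k" "t = a (Suc k) \<otimes> g" using assms by (auto simp: axis_stab_def)
  have "a (Suc k) \<otimes> t = (a (Suc k) \<otimes> a (Suc k)) \<otimes> g"
    using assms g tower_closed[of k] a_closed[of "Suc k"] by (simp add: m_assoc)
  then show ?thesis using assms g by (simp add: a_square axis_stab_def tower_mult z_in_tower)
qed (auto simp: axis_stab_def)

lemma axis_stab_mult:
  assumes "Suc k < n" "t \<in> axis_stab k" "u \<in> axis_stab k"
  shows "t \<otimes> u \<in> axis_stab k"
proof (cases "t \<in> tower k")
  case False
  then obtain g where g: "g \<in> tower k" "t = a (Suc k) \<otimes> g" using assms by (auto simp: axis_stab_def)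
  have "t \<otimes> u = a (Suc k) \<otimes> (g \<otimes> u)"
    using assms g tower_closed[of k] a_closed[of "Suc k"] axis_stab_closed by (simp add: m_assoc)
  then show ?thesis using a_axis_stab tower_axis_stab g assms by simp
qed (use assms tower_axis_stab in auto)

text \<open>The product \<open>R\<^sub>j R\<^sub>j\<^sub>+\<^sub>1 \<dots> R\<^sub>k\<^sub>+\<^sub>1\<close> of the last \<open>m\<close> generators. In the model it takes \<open>e\<^sub>k\<^sub>+\<^sub>2\<close> to
  \<open>\<plusminus> e\<^sub>j\<close>, with \<open>j = k + 2 - m\<close>.\<close>

primrec coset_rep :: "nat \<Rightarrow> nat \<Rightarrow> 'a"
where
  "coset_rep k 0 = \<one>"
| "coset_rep k (Suc m) = r (Suc k - m) \<otimes> coset_rep k m"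

lemma coset_rep_in_tower: "Suc k < n \<Longrightarrow> m \<le> Suc k \<Longrightarrow> coset_rep k m \<in> tower (Suc k)"
  by (induction m) (simp_all add: tower_one tower_mult r_in_tower)

lemma coset_rep_closed: "Suc k < n \<Longrightarrow> m \<le> Suc k \<Longrightarrow> coset_rep k m \<in> carrier G"
  using coset_rep_in_tower tower_closed by blast

lemma r_coset_rep_commute:
  assumes "Suc k < n" "1 \<le> i"
  shows "i + m \<le> k \<Longrightarrow> r i \<otimes> coset_rep k m = coset_rep k m \<otimes> r i"
proof (induction m)
  case (Suc m)
  then show ?case using assms unfolding coset_rep.simps
    by (intro conj_mult far_commute') (auto intro: r_closed coset_rep_closed)
qed (use assms r_closed in auto)

text \<open>Braid relation: \<open>R\<^sub>i\<close> commutes with the generators before \<open>R\<^sub>i\<^sub>-\<^sub>1\<close>, then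
  \<open>R\<^sub>i R\<^sub>i\<^sub>-\<^sub>1 R\<^sub>i = R\<^sub>i\<^sub>-\<^sub>1 R\<^sub>i R\<^sub>i\<^sub>-\<^sub>1\<close>, and the new \<open>R\<^sub>i\<^sub>-\<^sub>1\<close> commutes with the generators after \<open>R\<^sub>i\<close>.\<close>

lemma r_coset_rep_shift:
  assumes "Suc k < n" "i \<le> Suc k"
  shows "m \<le> Suc k \<Longrightarrow> Suc k + 1 < i + m \<Longrightarrow> r i \<otimes> coset_rep k m = coset_rep k m \<otimes> r (i - 1)"
proof (induction m)
  case (Suc m)
  define j where "j = Suc k - m"
  have j: "1 \<le> j" "j \<le> Suc k" "j + m = Suc k" using Suc.prems by (auto simp: j_def)
  have i: "j + 1 \<le> i" using Suc.prems j by auto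
  have cl: "r i \<in> carrier G" "r j \<in> carrier G" "r (i - 1) \<in> carrier G" "coset_rep k m \<in> carrier G"
    using assms i j by (auto intro: r_closed coset_rep_closed)
  show ?case
  proof (cases "i = j + 1")
    case True
    then obtain l where l: "m = Suc l" using assms(2) j by (cases m) auto
    have yl: "coset_rep k l \<in> carrier G" using assms l j by (auto intro: coset_rep_closed)
    have "Suc k - l = i" using l j True by simp
    then have ym: "coset_rep k m = r i \<otimes> coset_rep k l" using l by simp
    have "r i \<otimes> coset_rep k (Suc m) = (r i \<otimes> (r j \<otimes> r i)) \<otimes> coset_rep k l"
      using cl yl by (simp add: ym m_assoc flip: j_def)
    also have "r i \<otimes> (r j \<otimes> r i) = r j \<otimes> (r i \<otimes> r j)"
      using braid[of j] True j assms by simp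
    also have "(r j \<otimes> (r i \<otimes> r j)) \<otimes> coset_rep k l = (r j \<otimes> r i) \<otimes> (r j \<otimes> coset_rep k l)"
      using cl yl by (simp add: m_assoc)
    also have "r j \<otimes> coset_rep k l = coset_rep k l \<otimes> r j"
      using assms j l by (intro r_coset_rep_commute) auto
    also have "(r j \<otimes> r i) \<otimes> (coset_rep k l \<otimes> r j) = coset_rep k (Suc m) \<otimes> r (i - 1)"
      using cl yl True by (simp add: ym m_assoc flip: j_def)
    finally show ?thesis .
  next
    case False
    have "r i \<otimes> r j = r j \<otimes> r i"
      using False i j assms by (intro far_commute') auto
    then have "r i \<otimes> coset_rep k (Suc m) = r j \<otimes> (r i \<otimes> coset_rep k m)"
      using cl by (simp flip: j_def m_assoc)
    also have "\<dots> = r j \<otimes> (coset_rep k m \<otimes> r (i - 1))"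
      using Suc False i j by simp
    finally show ?thesis using cl by (simp add: m_assoc flip: j_def)
  qed
qed (use assms in auto)

text \<open>The crucial case of the enumeration: the half turn \<open>a\<^sub>j\<close>, with \<open>j = k + 1 - m\<close>, must only change the
  sign of the vertex \<open>\<plusminus> e\<^sub>j\<^sub>+\<^sub>1\<close> to which the representative leads. Induction on \<open>m\<close>: \<open>a_past_r\<close> moves \<open>a\<^sub>j\<close> past the first factor
  \<open>R\<^sub>j\<^sub>+\<^sub>1\<close> at the cost of a factor \<open>a\<^sub>j\<^sub>+\<^sub>1\<close>, to which the induction hypothesis applies, while \<open>a\<^sub>j\<close>
  itself commutes with the remaining factors.\<close>

lemma a_coset_rep:
  assumes "Suc k < n"
  shows "m \<le> k \<Longrightarrow> \<exists>t\<in>axis_stab k. a (Suc k - m) \<otimes> coset_rep k m = coset_rep k m \<otimes> t"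
proof (induction m)
  case 0
  have "a (Suc k) \<otimes> \<one> \<in> axis_stab k" using tower_one by (auto simp: axis_stab_def)
  then show ?case using a_closed[of "Suc k"] assms by (intro bexI[of _ "a (Suc k)"]) auto
next
  case (Suc m)
  define j where "j = k - m"
  have j: "1 \<le> j" "j + 1 = Suc k - m" "j + m = k" "Suc k - Suc m = j"
    using Suc.prems by (auto simp: j_def)
  obtain t where t: "t \<in> axis_stab k" "a (j + 1) \<otimes> coset_rep k m = coset_rep k m \<otimes> t" using Suc j by auto
  have jn: "j + 1 < n" "j < n" using j assms by auto
  have cl: "r j \<in> carrier G" "r (j + 1) \<in> carrier G" "a j \<in> carrier G" "a (j + 1) \<in> carrier G"
    "coset_rep k m \<in> carrier G" "t \<in> carrier G" "z \<in> carrier G"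
    using assms j jn t Suc.prems by (auto intro: r_closed coset_rep_closed a_closed axis_stab_closed z_closed)
  have com: "a j \<otimes> coset_rep k m = coset_rep k m \<otimes> a j"
    using r_coset_rep_commute[of k j m] j cl assms unfolding a_def by (metis m_assoc eq_refl)
  have comz: "z \<otimes> coset_rep k m = coset_rep k m \<otimes> z"
    using assms Suc.prems by (intro z_central[of "Suc k"] coset_rep_in_tower) auto
  have yS: "coset_rep k (Suc m) = r (j + 1) \<otimes> coset_rep k m"
    by (simp only: coset_rep.simps j(2))
  have "a (Suc k - Suc m) \<otimes> coset_rep k (Suc m) = (a j \<otimes> r (j + 1)) \<otimes> coset_rep k m"
    using cl by (simp only: yS j(4) m_assoc)
  also have "\<dots> = r (j + 1) \<otimes> (a (j + 1) \<otimes> (z \<otimes> (a j \<otimes> coset_rep k m)))"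
    using cl by (simp only: a_past_r[OF j(1) jn(1)]) (simp add: m_assoc)
  also have "\<dots> = r (j + 1) \<otimes> (a (j + 1) \<otimes> ((z \<otimes> coset_rep k m) \<otimes> a j))"
    using cl by (simp add: com m_assoc)
  also have "\<dots> = r (j + 1) \<otimes> ((a (j + 1) \<otimes> coset_rep k m) \<otimes> (z \<otimes> a j))"
    using cl by (simp add: comz m_assoc)
  also have "\<dots> = coset_rep k (Suc m) \<otimes> (t \<otimes> (z \<otimes> a j))"
    using cl by (simp only: t yS m_assoc m_closed)
  finally have "a (Suc k - Suc m) \<otimes> coset_rep k (Suc m) = coset_rep k (Suc m) \<otimes> (t \<otimes> (z \<otimes> a j))" .
  moreover have "z \<otimes> a j \<in> tower k" using assms j by (intro tower_mult z_in_tower a_in_tower) auto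
  then have "z \<otimes> a j \<in> axis_stab k" by (simp add: axis_stab_def)
  then have "t \<otimes> (z \<otimes> a j) \<in> axis_stab k"
    by (rule axis_stab_mult[OF assms t(1)])
  ultimately show ?case by blast
qed

definition coset_union :: "nat \<Rightarrow> 'a set" where "coset_union k = {coset_rep k m \<otimes> t | m t. m \<le> Suc k \<and> t \<in> axis_stab k}"

text \<open>Left multiplication by \<open>R\<^sub>i\<close> permutes the cosets in the way the quarter turn moves the vertices. With
  \<open>j = k + 2 - m\<close> the index of the vertex, the four cases are \<open>i < j - 1\<close>, where \<open>R\<^sub>i\<close> passes through the
  representative; \<open>i = j - 1\<close>, where the representative grows; \<open>i = j\<close>, where it shrinks; and
  \<open>i > j\<close>, where \<open>R\<^sub>i\<close> passes through as \<open>R\<^sub>i\<^sub>-\<^sub>1\<close>.\<close>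

lemma r_coset_union:
  assumes "Suc k < n" "1 \<le> i" "i \<le> Suc k" "u \<in> coset_union k"
  shows "r i \<otimes> u \<in> coset_union k"
proof -
  obtain m t where m: "m \<le> Suc k" and t: "t \<in> axis_stab k" and u: "u = coset_rep k m \<otimes> t"
    using assms by (auto simp: coset_union_def)
  have cl: "r i \<in> carrier G" "coset_rep k m \<in> carrier G" "t \<in> carrier G"
    using assms m t by (auto intro: r_closed coset_rep_closed axis_stab_closed)
  have "\<exists>m' t'. m' \<le> Suc k \<and> t' \<in> axis_stab k \<and> r i \<otimes> coset_rep k m = coset_rep k m' \<otimes> t'"
  proof -
    consider "i + m \<le> k" | "i + m = Suc k" | "i + m = Suc k + 1" | "Suc k + 1 < i + m" by linarith
    then show ?thesis
    proof cases
      case 1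
      then have "r i \<in> axis_stab k" using assms r_in_tower[of i k] by (simp add: axis_stab_def)
      then show ?thesis using r_coset_rep_commute 1 m assms by blast
    next
      case 2
      have "r i \<otimes> coset_rep k m = coset_rep k (Suc m) \<otimes> \<one>" using 2 cl by (simp add: add_implies_diff flip: 2)
      moreover have "\<one> \<in> axis_stab k" "Suc m \<le> Suc k" using tower_one 2 assms by (auto simp: axis_stab_def)
      ultimately show ?thesis by blast
    next
      case 3
      then obtain l where l: "m = Suc l" using assms by (cases m) auto
      have i: "i = Suc k - l" using 3 l by simp
      have yl: "coset_rep k l \<in> carrier G" using l m assms by (intro coset_rep_closed) auto
      have "r i \<otimes> coset_rep k m = a (Suc k - l) \<otimes> coset_rep k l" using cl yl by (simp add: l i a_def m_assoc)
      then show ?thesis using a_coset_rep[of k l] assms l m by (metis Suc_leD Suc_le_mono)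
    next
      case 4
      have "r (i - 1) \<in> axis_stab k" using 4 m assms r_in_tower[of "i - 1" k] by (simp add: axis_stab_def)
      then show ?thesis using r_coset_rep_shift 4 m assms by blast
    qed
  qed
  then obtain m' t' where *: "m' \<le> Suc k" "t' \<in> axis_stab k" "r i \<otimes> coset_rep k m = coset_rep k m' \<otimes> t'" by blast
  have "r i \<otimes> u = (r i \<otimes> coset_rep k m) \<otimes> t" using cl by (simp add: u m_assoc)
  also have "\<dots> = coset_rep k m' \<otimes> (t' \<otimes> t)"
    using * cl axis_stab_closed[of k t'] coset_rep_closed[of k m'] assms(1) by (simp add: m_assoc)
  finally show ?thesis using * t axis_stab_mult[OF assms(1)] by (auto simp: coset_union_def)
qed

lemma z_coset_union:
  assumes "Suc k < n" "u \<in> coset_union k"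
  shows "z \<otimes> u \<in> coset_union k"
proof -
  obtain m t where m: "m \<le> Suc k" and t: "t \<in> axis_stab k" and u: "u = coset_rep k m \<otimes> t"
    using assms by (auto simp: coset_union_def)
  have cl: "coset_rep k m \<in> carrier G" "t \<in> carrier G"
    using assms m t by (auto intro: coset_rep_closed axis_stab_closed)
  have "z \<otimes> u = coset_rep k m \<otimes> (z \<otimes> t)"
    using z_central[of "Suc k" "coset_rep k m"] assms m cl z_closed
    by (simp add: u coset_rep_in_tower flip: m_assoc)
  then show ?thesis using m t tower_axis_stab[OF assms(1) z_in_tower t] by (auto simp: coset_union_def)
qed

lemma tower_subset_coset_union:
  assumes "Suc k < n"
  shows "tower (Suc k) \<subseteq> coset_union k"
proof
  have Ucl: "u \<in> carrier G" if "u \<in> coset_union k" for u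
    using that assms by (auto simp: coset_union_def intro: coset_rep_closed axis_stab_closed)
  \<comment> \<open>The inverse of a generator is a positive power of it, since its order divides 8.\<close>
  have left: "g \<otimes> u \<in> coset_union k" if "g \<in> tower (Suc k)" "u \<in> coset_union k" for g u
    using that unfolding tower_def
  proof (induction arbitrary: u rule: generate.induct)
    case one
    then show ?case using Ucl by simp
  next
    case (incl h)
    then show ?case using assms by (auto intro: r_coset_union z_coset_union)
  next
    case (inv h)
    then consider "h = z" | i where "h = r i" "1 \<le> i" "i \<le> Suc k" by auto
    then show ?case
    proof cases
      case 1
      then show ?thesis using inv assms by (simp add: inv_z z_coset_union)
    next
      case 2
      then have "inv h \<otimes> u = r i \<otimes> (r i \<otimes> (r i \<otimes> (z \<otimes> u)))"
        using assms inv_r[of i] r_closed[of i] z_closed Ucl[OF inv(2)] by (simp add: m_assoc)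
      then show ?thesis using 2 inv assms by (simp add: r_coset_union z_coset_union)
    qed
  next
    case (eng g h)
    then have "g \<in> carrier G" "h \<in> carrier G"
      using tower_closed[of "Suc k"] assms by (auto simp: tower_def)
    then have "(g \<otimes> h) \<otimes> u = g \<otimes> (h \<otimes> u)" using Ucl eng.prems by (simp add: m_assoc)
    then show ?case using eng by simp
  qed
  fix g assume g: "g \<in> tower (Suc k)"
  have "\<one> \<in> coset_union k" using tower_one[of k] by (force simp: coset_union_def axis_stab_def intro: exI[of _ 0])
  then have "g \<otimes> \<one> \<in> coset_union k" using left g by blast
  then show "g \<in> coset_union k" using tower_closed[OF assms g] by simp
qed

end

section \<open>Quarter turns of the hyperoctahedron\<close>

lemma mult_mat_unit_vec:
  "A \<in> carrier_mat n n \<Longrightarrow> j < n \<Longrightarrow> A *\<^sub>v unit_vec n j = col A j"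
  for A :: "real mat"
  by (intro eq_vecI) auto

lemma mat_eq_unit_vecI:
  fixes A B :: "real mat"
  assumes "A \<in> carrier_mat n n" "B \<in> carrier_mat n n"
    and "\<And>j. j < n \<Longrightarrow> A *\<^sub>v unit_vec n j = B *\<^sub>v unit_vec n j"
  shows "A = B"
proof (rule mat_col_eqI)
  fix j assume "j < dim_col B"
  then show "col A j = col B j"
    using assms(2) assms(3)[of j] mult_mat_unit_vec[OF assms(1), of j] mult_mat_unit_vec[OF assms(2), of j]
    by simp
qed (use assms in auto)

text \<open>The vertices are the cases \<open>s = 1\<close> and \<open>s = - 1\<close>, which linear maps treat alike.\<close>

definition signed_unit :: "nat \<Rightarrow> real \<Rightarrow> nat \<Rightarrow> real vec"
  where "signed_unit n s j = s \<cdot>\<^sub>v unit_vec n j"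

lemma signed_unit_carrier [simp]: "signed_unit n s j \<in> carrier_vec n"
  by (simp add: signed_unit_def)

lemma mult_mat_signed_unit:
  "A \<in> carrier_mat n n \<Longrightarrow> A *\<^sub>v signed_unit n s j = s \<cdot>\<^sub>v (A *\<^sub>v unit_vec n j)"
  by (simp add: signed_unit_def mult_mat_vec[of _ n n])

lemma scalar_prod_signed_unit:
  "i < n \<Longrightarrow> j < n \<Longrightarrow> signed_unit n s i \<bullet> signed_unit n t j = (if i = j then s * t else 0)"
  by (simp add: signed_unit_def)

lemma signed_unit_eq_iff:
  assumes "i < n" "j < n" "s \<noteq> 0"
  shows "signed_unit n s i = signed_unit n t j \<longleftrightarrow> i = j \<and> s = t"
proof
  assume eq: "signed_unit n s i = signed_unit n t j"
  have "s = (if i = j then t else 0)"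
    using arg_cong[OF eq, of "\<lambda>v. v $ i"] assms
    by (simp add: signed_unit_def unit_vec_def split: if_splits)
  then show "i = j \<and> s = t" using assms by (auto split: if_splits)
qed auto

lemma unit_vec_eq_signed_unit: "unit_vec n j = signed_unit n 1 j"
  by (simp add: signed_unit_def)

lemma hyperoctahedron_vertices_alt:
  "hyperoctahedron_vertices n = {signed_unit n s j | s j. s \<in> {1, - 1} \<and> j < n}"
proof -
  have "signed_unit n (- 1) j = - unit_vec n j" for j
    by (auto simp: signed_unit_def)
  then have "{unit_vec n j, - unit_vec n j} = {signed_unit n 1 j, signed_unit n (- 1) j}" for j
    by (simp flip: unit_vec_eq_signed_unit)
  also have "{signed_unit n 1 j, signed_unit n (- 1) j} = {signed_unit n s j | s. s \<in> {1, - 1}}" for j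
    by blast
  finally show ?thesis unfolding hyperoctahedron_vertices_def by auto
qed

text \<open>From here on coordinates are numbered from 0, generators still from 1. This matrix takes \<open>e\<^sub>i\<^sub>-\<^sub>1\<close> to \<open>e\<^sub>i\<close> and \<open>e\<^sub>i\<close> to
  \<open>- e\<^sub>i\<^sub>-\<^sub>1\<close>. Writing it as a product of elementary matrices gives its determinant at once.\<close>

definition quarter_turn :: "nat \<Rightarrow> nat \<Rightarrow> real mat"
  where "quarter_turn n i = swaprows_mat n (i - 1) i * multrow_mat n i (- 1)"

lemma quarter_turn_carrier: "quarter_turn n i \<in> carrier_mat n n"
  unfolding quarter_turn_def by (rule mult_carrier_mat[of _ n n]) auto

lemma quarter_turn_signed_unit:
  assumes "1 \<le> i" "i < n" "j < n"
  shows "quarter_turn n i *\<^sub>v signed_unit n s j =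
    (if j + 1 = i then signed_unit n s i else if j = i then signed_unit n (- s) (i - 1)
     else signed_unit n s j)"
proof -
  have m: "multrow_mat n i (- 1) *\<^sub>v unit_vec n j = signed_unit n (if j = i then - 1 else 1) j"
    using assms by (subst mult_mat_unit_vec) (auto intro!: eq_vecI simp: unit_vec_def signed_unit_def)
  have s: "swaprows_mat n (i - 1) i *\<^sub>v unit_vec n j =
    (unit_vec n (if j + 1 = i then i else if j = i then i - 1 else j) :: real vec)"
    using assms by (subst mult_mat_unit_vec) (auto intro!: eq_vecI simp: unit_vec_def)
  have "quarter_turn n i *\<^sub>v signed_unit n s j =
    s \<cdot>\<^sub>v (swaprows_mat n (i - 1) i *\<^sub>v (multrow_mat n i (- 1) *\<^sub>v unit_vec n j))"
    unfolding mult_mat_signed_unit[OF quarter_turn_carrier] unfolding quarter_turn_def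
    by (subst assoc_mult_mat_vec[of _ n n _ n]) auto
  also have "\<dots> = s \<cdot>\<^sub>v ((if j = i then - 1 else 1) \<cdot>\<^sub>v
      unit_vec n (if j + 1 = i then i else if j = i then i - 1 else j))"
    unfolding m mult_mat_signed_unit[OF swaprows_mat_carrier] s ..
  finally show ?thesis using assms by (auto simp: signed_unit_def smult_smult_assoc)
qed

lemma det_quarter_turn: "1 \<le> i \<Longrightarrow> i < n \<Longrightarrow> det (quarter_turn n i) = 1"
  unfolding quarter_turn_def
  by (subst det_mult[of _ n]) (auto simp: det_swaprows_mat det_multrow_mat)

lemma quarter_turn_orthogonal:
  assumes "1 \<le> i" "i < n"
  shows "(quarter_turn n i)\<^sup>T * quarter_turn n i = 1\<^sub>m n"
proof (rule eq_matI)
  have c: "col (quarter_turn n i) j =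
    (if j + 1 = i then signed_unit n 1 i else if j = i then signed_unit n (- 1) (i - 1)
     else signed_unit n 1 j)" if "j < n" for j
    using quarter_turn_signed_unit[OF assms that, of 1] mult_mat_unit_vec[OF quarter_turn_carrier that, of i]
    by (simp flip: unit_vec_eq_signed_unit)
  fix j l assume "j < dim_row (1\<^sub>m n :: real mat)" "l < dim_col (1\<^sub>m n :: real mat)"
  then show "((quarter_turn n i)\<^sup>T * quarter_turn n i) $$ (j, l) = 1\<^sub>m n $$ (j, l)"
    using assms quarter_turn_carrier[of n i] by (auto simp: c scalar_prod_signed_unit)
qed (use quarter_turn_carrier[of n i] in auto)

lemma orthogonal_inj:
  fixes A :: "real mat"
  assumes "A \<in> carrier_mat n n" "A\<^sup>T * A = 1\<^sub>m n" "v \<in> carrier_vec n" "w \<in> carrier_vec n"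
    and "A *\<^sub>v v = A *\<^sub>v w"
  shows "v = w"
proof -
  have "A\<^sup>T *\<^sub>v (A *\<^sub>v u) = u" if "u \<in> carrier_vec n" for u
    using assms(1,2) that assoc_mult_mat_vec[of "A\<^sup>T" n n A n u] by simp
  then show ?thesis using assms by metis
qed

lemma finite_hyperoctahedron_vertices: "finite (hyperoctahedron_vertices n)"
  by (simp add: hyperoctahedron_vertices_def)

lemma rot_hyperoctahedralI:
  assumes "A \<in> carrier_mat n n" "A\<^sup>T * A = 1\<^sub>m n" "det A = 1"
    and "\<And>v. v \<in> hyperoctahedron_vertices n \<Longrightarrow> A *\<^sub>v v \<in> hyperoctahedron_vertices n"
  shows "A \<in> carrier (rot_hyperoctahedral_group n)"
proof -
  have "inj_on (\<lambda>v. A *\<^sub>v v) (hyperoctahedron_vertices n)"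
    using orthogonal_inj[OF assms(1,2)] hyperoctahedron_vertices_carrier[of n]
    by (auto intro!: inj_onI)
  then have "bij_betw (\<lambda>v. A *\<^sub>v v) (hyperoctahedron_vertices n) (hyperoctahedron_vertices n)"
    using assms(4) endo_inj_surj[OF finite_hyperoctahedron_vertices, of "\<lambda>v. A *\<^sub>v v" n]
    by (auto simp: bij_betw_def)
  then show ?thesis
    using assms by (simp add: rot_hyperoctahedral_group_def special_orthogonal_group_def)
qed

lemma quarter_turn_in_group:
  assumes "1 \<le> i" "i < n"
  shows "quarter_turn n i \<in> carrier (rot_hyperoctahedral_group n)"
proof (rule rot_hyperoctahedralI)
  fix v assume "v \<in> hyperoctahedron_vertices n"
  then obtain s j where v: "v = signed_unit n s j" "s \<in> {1, - 1}" "j < n"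
    by (auto simp: hyperoctahedron_vertices_alt)
  have "signed_unit n t l \<in> hyperoctahedron_vertices n" if "t \<in> {1, - 1}" "l < n" for t l
    using that by (auto simp: hyperoctahedron_vertices_alt)
  from this[of s i] this[of "- s" "i - 1"] this[of s j]
  show "quarter_turn n i *\<^sub>v v \<in> hyperoctahedron_vertices n"
    using quarter_turn_signed_unit[OF assms, of j s] assms v by auto
qed (use assms in \<open>auto simp: quarter_turn_carrier quarter_turn_orthogonal det_quarter_turn\<close>)

lemma rot_hyperoctahedral_simps:
  "monoid.mult (rot_hyperoctahedral_group n) = (*)" "one (rot_hyperoctahedral_group n) = 1\<^sub>m n"
  by (simp_all add: rot_hyperoctahedral_group_def special_orthogonal_group_def)

lemma rot_hyperoctahedralD:
  assumes "A \<in> carrier (rot_hyperoctahedral_group n)"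
  shows "A \<in> carrier_mat n n" "A\<^sup>T * A = 1\<^sub>m n" "det A = 1"
    "v \<in> hyperoctahedron_vertices n \<Longrightarrow> A *\<^sub>v v \<in> hyperoctahedron_vertices n"
  using assms
  by (auto simp: rot_hyperoctahedral_group_def special_orthogonal_group_def bij_betw_def)

lemma mat_eq_signed_unitI:
  assumes "A \<in> carrier_mat n n" "B \<in> carrier_mat n n"
    and "\<And>j. j < n \<Longrightarrow> A *\<^sub>v signed_unit n 1 j = B *\<^sub>v signed_unit n 1 j"
  shows "A = B"
  using assms by (auto intro!: mat_eq_unit_vecI simp flip: unit_vec_eq_signed_unit)

lemma quarter_turn_braid:
  assumes "1 \<le> i" "i + 1 < n"
  shows "quarter_turn n i * (quarter_turn n (i + 1) * quarter_turn n i) = quarter_turn n (i + 1) * (quarter_turn n i * quarter_turn n (i + 1))"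
  using assms
  by (intro mat_eq_signed_unitI[of _ n])
    (auto simp: assoc_mult_mat_vec[of _ n n _ n] quarter_turn_signed_unit quarter_turn_carrier mult_carrier_mat[of _ n n])

lemma quarter_turn_far_commute:
  assumes "1 \<le> i" "i + 2 \<le> j" "j < n"
  shows "quarter_turn n i * quarter_turn n j = quarter_turn n j * quarter_turn n i"
  using assms
  by (intro mat_eq_signed_unitI[of _ n])
    (auto simp: assoc_mult_mat_vec[of _ n n _ n] quarter_turn_signed_unit quarter_turn_carrier mult_carrier_mat[of _ n n])

lemma quarter_turn_first_square:
  assumes "3 \<le> n"
  shows "quarter_turn n 1 * quarter_turn n 1 = quarter_turn n 2 * (quarter_turn n 1 * (quarter_turn n 1 * quarter_turn n 2))"
  using assms
  by (intro mat_eq_signed_unitI[of _ n])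
    (auto simp: assoc_mult_mat_vec[of _ n n _ n] quarter_turn_signed_unit quarter_turn_carrier mult_carrier_mat[of _ n n])

section \<open>The action on the vertices\<close>

locale braid_rotation = braid_quotient_elements +
  fixes \<pi> :: "'a \<Rightarrow> real mat"
  assumes pi_hom: "\<pi> \<in> hom G (rot_hyperoctahedral_group n)"
    and pi_r: "1 \<le> i \<Longrightarrow> i < n \<Longrightarrow> \<pi> (r i) = quarter_turn n i"
begin

lemma pi_carrier: "g \<in> carrier G \<Longrightarrow> \<pi> g \<in> carrier (rot_hyperoctahedral_group n)"
  using pi_hom by (auto simp: hom_def)

lemma pi_mat: "g \<in> carrier G \<Longrightarrow> \<pi> g \<in> carrier_mat n n"
  using pi_carrier rot_hyperoctahedralD by blast

lemma pi_mult: "g \<in> carrier G \<Longrightarrow> h \<in> carrier G \<Longrightarrow> \<pi> (g \<otimes> h) = \<pi> g * \<pi> h"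
  using pi_hom by (auto simp: hom_def rot_hyperoctahedral_simps)

lemma pi_one: "\<pi> \<one> = 1\<^sub>m n"
  using hom_one[OF pi_hom is_group group_rot_hyperoctahedral_group]
  by (simp add: rot_hyperoctahedral_simps)

definition act :: "'a \<Rightarrow> real vec \<Rightarrow> real vec" where "act g v = \<pi> g *\<^sub>v v"

lemma act_mult: "g \<in> carrier G \<Longrightarrow> h \<in> carrier G \<Longrightarrow> v \<in> carrier_vec n \<Longrightarrow>
    act (g \<otimes> h) v = act g (act h v)"
  unfolding act_def by (simp add: pi_mult assoc_mult_mat_vec[of _ n n _ n] pi_mat)

lemma act_one: "v \<in> carrier_vec n \<Longrightarrow> act \<one> v = v"
  by (simp add: act_def pi_one)

lemma act_inv_fix: "g \<in> carrier G \<Longrightarrow> v \<in> carrier_vec n \<Longrightarrow> act g v = w \<Longrightarrow> act (inv g) w = v"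
  using act_mult[of "inv g" g v] act_one by simp

lemma act_r:
  assumes "1 \<le> i" "i < n" "j < n"
  shows "act (r i) (signed_unit n s j) =
    (if j + 1 = i then signed_unit n s i else if j = i then signed_unit n (- s) (i - 1)
     else signed_unit n s j)"
  using quarter_turn_signed_unit[OF assms] assms by (simp add: act_def pi_r)

lemma act_a:
  assumes "1 \<le> i" "i < n" "j < n"
  shows "act (a i) (signed_unit n s j) = signed_unit n (if j = i \<or> j + 1 = i then - s else s) j"
  using assms by (auto simp: a_def act_mult r_closed act_r)

lemma act_z: "j < n \<Longrightarrow> act z (signed_unit n s j) = signed_unit n s j"
  using n_ge by (simp add: z_def act_mult a_closed act_a)

lemma pi_z: "\<pi> z = 1\<^sub>m n"
  using act_z by (intro mat_eq_signed_unitI[of _ n]) (auto simp: act_def pi_mat z_closed)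

lemma act_tower_fixes:
  assumes "k < n" "g \<in> tower k" "k < j" "j < n"
  shows "act g (signed_unit n s j) = signed_unit n s j"
  using assms(2) unfolding tower_def
proof (induction rule: generate.induct)
  have gen: "act h (signed_unit n s j) = signed_unit n s j" if "h \<in> insert z (r ` {1..k})" for h
    using that assms by (auto simp: act_z act_r)
  {
    case one
    then show ?case by (simp add: act_one)
  next
    case (incl h)
    then show ?case by (rule gen)
  next
    case (inv h)
    then show ?case using gen tower_generators[OF assms(1)] by (intro act_inv_fix) auto
  next
    case (eng g h)
    then have "g \<in> carrier G" "h \<in> carrier G" using tower_closed[OF assms(1)] by (auto simp: tower_def)
    then show ?case using eng by (simp add: act_mult)
  }
qed

lemma act_coset_rep:
  assumes "Suc k < n"
  shows "m \<le> Suc k \<Longrightarrow> act (coset_rep k m) (signed_unit n s (Suc k)) = signed_unit n ((- 1) ^ m * s) (Suc k - m)"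
proof (induction m)
  case 0
  then show ?case using act_one by simp
next
  case (Suc m)
  define j where "j = k - m"
  have j: "Suc k - m = Suc j" "Suc k - Suc m = j" "Suc j < n" using Suc.prems assms by (auto simp: j_def)
  show ?case
    using Suc j assms act_r[of "Suc j" "Suc j"]
    by (simp add: act_mult r_closed coset_rep_closed del: One_nat_def)
qed

text \<open>Each coset found by the enumeration takes \<open>e\<^sub>k\<^sub>+\<^sub>1\<close> to a vertex of its own, and only \<open>S\<^sub>k\<close> itself
  fixes it. This is what makes the upper bound sharp.\<close>

lemma coset_cases:
  assumes "Suc k < n" "g \<in> tower (Suc k)"
  obtains m s where "m \<le> Suc k" "s \<in> {1, - 1}"
    "act g (signed_unit n 1 (Suc k)) = signed_unit n s (Suc k - m)"
    "m = 0 \<and> s = 1 \<longrightarrow> g \<in> tower k"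
proof -
  obtain m t where m: "m \<le> Suc k" and t: "t \<in> axis_stab k" and g: "g = coset_rep k m \<otimes> t"
    using tower_subset_coset_union[OF assms(1)] assms(2) by (auto simp: coset_union_def)
  have cl: "coset_rep k m \<in> carrier G" "t \<in> carrier G" using assms m t by (auto intro: coset_rep_closed axis_stab_closed)
  show ?thesis
  proof (cases "t \<in> tower k")
    case True
    have "act g (signed_unit n 1 (Suc k)) = signed_unit n ((- 1) ^ m) (Suc k - m)"
      using assms cl m act_tower_fixes[of k t] True by (simp add: g act_mult act_coset_rep)
    moreover have "m = 0 \<Longrightarrow> g \<in> tower k" using g True cl by simp
    ultimately show ?thesis using that[of m "(- 1) ^ m"] m by (cases "even m") auto
  next
    case False
    then obtain h where h: "h \<in> tower k" "t = a (Suc k) \<otimes> h" using t by (auto simp: axis_stab_def)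
    then have "h \<in> carrier G" using assms tower_closed[of k] by auto
    then have "act g (signed_unit n 1 (Suc k)) = signed_unit n (- ((- 1) ^ m)) (Suc k - m)"
      using assms cl m act_tower_fixes[of k h] h by (simp add: g act_mult act_a a_closed act_coset_rep)
    then show ?thesis using that[of m "- ((- 1) ^ m)"] m by (cases "even m") auto
  qed
qed

lemma tower_stabiliser:
  assumes "Suc k < n" "g \<in> tower (Suc k)" "act g (signed_unit n 1 (Suc k)) = signed_unit n 1 (Suc k)"
  shows "g \<in> tower k"
proof -
  obtain m s where ms: "m \<le> Suc k" "s \<in> {1, - 1}"
    "act g (signed_unit n 1 (Suc k)) = signed_unit n s (Suc k - m)"
    "m = 0 \<and> s = 1 \<longrightarrow> g \<in> tower k"
    by (rule coset_cases[OF assms(1,2)])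
  then have "Suc k = Suc k - m \<and> 1 = s"
    using assms signed_unit_eq_iff[of "Suc k" n "Suc k - m" 1 s] by simp
  then have "m = 0" "s = 1" by linarith+
  then show ?thesis using ms by simp
qed

lemma tower_transitive:
  assumes "Suc k < n" "j \<le> Suc k" "s \<in> {1, - 1}"
  shows "\<exists>g\<in>tower (Suc k). act g (signed_unit n 1 (Suc k)) = signed_unit n s j"
proof -
  define m where "m = Suc k - j"
  have m: "m \<le> Suc k" "Suc k - m = j" using assms by (auto simp: m_def)
  have cl: "coset_rep k m \<in> carrier G" "a (Suc k) \<in> carrier G" using assms m by (auto intro: coset_rep_closed a_closed)
  show ?thesis
  proof (cases "s = (- 1) ^ m")
    case True
    then show ?thesis using act_coset_rep[of k m 1] coset_rep_in_tower[of k m] assms m by auto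
  next
    case False
    then have s: "s = - ((- 1) ^ m)" using assms(3) by (cases "even m") auto
    have "act (coset_rep k m \<otimes> a (Suc k)) (signed_unit n 1 (Suc k)) = signed_unit n s j"
      using assms cl m by (simp add: act_mult act_a act_coset_rep s)
    moreover have "coset_rep k m \<otimes> a (Suc k) \<in> tower (Suc k)"
      using assms m by (intro tower_mult coset_rep_in_tower a_in_tower) auto
    ultimately show ?thesis by blast
  qed
qed

text \<open>Orbit-stabiliser theorem for the action of \<open>S\<^sub>k\<^sub>+\<^sub>1\<close> on the vertices \<open>\<plusminus> e\<^sub>0, \<dots>, \<plusminus> e\<^sub>k\<^sub>+\<^sub>1\<close>.\<close>

lemma card_tower_Suc:
  assumes "Suc k < n"
  shows "card (tower (Suc k)) = 2 * (k + 2) * card (tower k)"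
proof -
  let ?I = "{1, - 1} \<times> {..Suc k} :: (real \<times> nat) set"
  let ?e = "signed_unit n 1 (Suc k)"
  have "\<forall>p\<in>?I. \<exists>g. g \<in> tower (Suc k) \<and> act g ?e = signed_unit n (fst p) (snd p)"
    using tower_transitive[OF assms] by auto
  then obtain x where x: "\<And>p. p \<in> ?I \<Longrightarrow> x p \<in> tower (Suc k)"
    "\<And>p. p \<in> ?I \<Longrightarrow> act (x p) ?e = signed_unit n (fst p) (snd p)"
    by metis
  have xcl: "x p \<in> carrier G" if "p \<in> ?I" for p using x(1)[OF that] tower_closed assms by blast
  have scl: "h \<in> carrier G" if "h \<in> tower k" for h using that tower_closed[of k] assms by simp
  have sS: "tower k \<subseteq> tower (Suc k)" using assms by (intro tower_mono) auto
  have act: "act (x p \<otimes> h) ?e = signed_unit n (fst p) (snd p)" if "p \<in> ?I" "h \<in> tower k" for p h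
    using that assms act_tower_fixes[of k h] by (simp add: act_mult xcl scl x(2))
  have "bij_betw (\<lambda>(p, h). x p \<otimes> h) (?I \<times> tower k) (tower (Suc k))"
  proof (rule bij_betwI')
    fix u v assume u: "u \<in> ?I \<times> tower k" and v: "v \<in> ?I \<times> tower k"
    obtain p h q h' where uv: "u = (p, h)" "v = (q, h')" by (cases u, cases v)
    show "((case u of (p, h) \<Rightarrow> x p \<otimes> h) = (case v of (p, h) \<Rightarrow> x p \<otimes> h)) = (u = v)"
    proof
      assume "(case u of (p, h) \<Rightarrow> x p \<otimes> h) = (case v of (p, h) \<Rightarrow> x p \<otimes> h)"
      then have eq: "x p \<otimes> h = x q \<otimes> h'" by (simp add: uv)
      have pq: "p \<in> ?I" "h \<in> tower k" "q \<in> ?I" "h' \<in> tower k" using u v by (auto simp: uv)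
      have "signed_unit n (fst p) (snd p) = signed_unit n (fst q) (snd q)"
        using act[OF pq(1,2)] act[OF pq(3,4)] eq by simp
      then have "p = q"
        using pq assms signed_unit_eq_iff[of "snd p" n "snd q" "fst p" "fst q"]
        by (auto simp: prod_eq_iff)
      then show "u = v" using eq pq xcl scl by (simp add: uv)
    qed simp
  next
    fix u assume "u \<in> ?I \<times> tower k"
    then show "(case u of (p, h) \<Rightarrow> x p \<otimes> h) \<in> tower (Suc k)"
      using x(1) sS tower_mult[OF assms] by auto
  next
    fix g assume g: "g \<in> tower (Suc k)"
    obtain m s where ms: "m \<le> Suc k" "s \<in> {1, - 1}"
      "act g ?e = signed_unit n s (Suc k - m)"
      by (rule coset_cases[OF assms g])
    let ?p = "(s, Suc k - m)"
    have p: "?p \<in> ?I" using ms by auto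
    have gcl: "g \<in> carrier G" using tower_closed assms g by blast
    have "act (inv (x ?p) \<otimes> g) ?e = ?e"
      using xcl[OF p] gcl x(2)[OF p] ms act_inv_fix[OF xcl[OF p], of ?e] by (simp add: act_mult)
    moreover have "inv (x ?p) \<otimes> g \<in> tower (Suc k)" using tower_inv_mult[OF assms x(1)[OF p] g] .
    ultimately have "inv (x ?p) \<otimes> g \<in> tower k" using tower_stabiliser[OF assms] by blast
    moreover have "g = x ?p \<otimes> (inv (x ?p) \<otimes> g)"
      using xcl[OF p] gcl by (simp flip: m_assoc)
    ultimately show "\<exists>u\<in>?I \<times> tower k. g = (case u of (p, h) \<Rightarrow> x p \<otimes> h)"
      using p by (intro bexI[of _ "(?p, inv (x ?p) \<otimes> g)"]) auto
  qed
  then have "card (tower (Suc k)) = card (?I \<times> tower k)" by (rule bij_betw_same_card[symmetric])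
  then show ?thesis by (simp add: card_cartesian_product)
qed

lemma card_tower:
  assumes "z \<noteq> \<one>"
  shows "k < n \<Longrightarrow> card (tower k) = 2 ^ (k + 1) * fact (k + 1)"
proof (induction k)
  case 0
  then show ?case using assms by (simp add: tower_0)
next
  case (Suc k)
  then show ?case using card_tower_Suc[of k] by (simp add: algebra_simps)
qed

text \<open>An element acting trivially fixes every vertex, so \<open>tower_stabiliser\<close> pushes it down the chain.\<close>

lemma kernel_in_tower:
  assumes "g \<in> tower k" "k < n" "\<pi> g = 1\<^sub>m n"
  shows "g \<in> {\<one>, z}"
  using assms
proof (induction k)
  case (Suc k)
  have "g \<in> tower k" using Suc.prems by (intro tower_stabiliser[of k g]) (simp_all add: act_def)
  then show ?case using Suc.IH Suc.prems by simp
qed (simp add: tower_0)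

text \<open>Induction on the number of coordinates that are possibly moved. By transitivity an element of the
  image agrees with \<open>A\<close> on the last of them, and dividing by it leaves one coordinate less. At the
  end only the sign of \<open>e\<^sub>0\<close> is left, which the determinant fixes.\<close>

lemma pi_surj:
  assumes "k < n" "A \<in> carrier (rot_hyperoctahedral_group n)"
    and "\<And>j. k < j \<Longrightarrow> j < n \<Longrightarrow> A *\<^sub>v signed_unit n 1 j = signed_unit n 1 j"
  shows "\<exists>g\<in>tower k. \<pi> g = A"
  using assms
proof (induction k arbitrary: A)
  have vertex: "\<exists>s j. s \<in> {1, - 1} \<and> j \<le> k \<and> A *\<^sub>v signed_unit n 1 k = signed_unit n s j"
    if k: "k < n" and A: "A \<in> carrier (rot_hyperoctahedral_group n)"
      and above: "\<And>j. k < j \<Longrightarrow> j < n \<Longrightarrow> A *\<^sub>v signed_unit n 1 j = signed_unit n 1 j" for A k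
  proof -
    have "A *\<^sub>v signed_unit n 1 k \<in> hyperoctahedron_vertices n"
      using k by (intro rot_hyperoctahedralD(4)[OF A]) (auto simp: hyperoctahedron_vertices_alt)
    then obtain s j where sj: "s \<in> {1, - 1}" "j < n" "A *\<^sub>v signed_unit n 1 k = signed_unit n s j"
      by (auto simp: hyperoctahedron_vertices_alt)
    have "j \<le> k"
    proof (rule ccontr)
      assume "\<not> j \<le> k"
      then have "A *\<^sub>v signed_unit n 1 j = signed_unit n 1 j" using above sj by simp
      then have "A *\<^sub>v unit_vec n j = unit_vec n j" by (simp flip: unit_vec_eq_signed_unit)
      then have "A *\<^sub>v signed_unit n s j = signed_unit n s j"
        using rot_hyperoctahedralD(1)[OF A] by (simp add: mult_mat_signed_unit) (simp add: signed_unit_def)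
      then have "A *\<^sub>v signed_unit n 1 k = A *\<^sub>v signed_unit n s j" by (simp only: sj)
      then have "signed_unit n 1 k = signed_unit n s j"
        by (rule orthogonal_inj[OF rot_hyperoctahedralD(1,2)[OF A] signed_unit_carrier signed_unit_carrier])
      then show False using \<open>\<not> j \<le> k\<close> sj k signed_unit_eq_iff[of k n j 1 s] by auto
    qed
    then show ?thesis using sj by blast
  qed
  {
    case 0
    \<comment> \<open>Here \<open>A\<close> is the identity or a reflection.\<close>
    obtain s j where sj: "s \<in> {1, - 1}" "j \<le> 0" "A *\<^sub>v signed_unit n 1 0 = signed_unit n s j"
      using vertex[OF 0] by blast
    have m: "multrow_mat n 0 s *\<^sub>v signed_unit n 1 j = signed_unit n (if j = 0 then s else 1) j"
      if "j < n" for j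
      using that by (subst mult_mat_signed_unit, simp, subst mult_mat_unit_vec)
        (auto intro!: eq_vecI simp: unit_vec_def signed_unit_def)
    have "A = multrow_mat n 0 s"
    proof (rule mat_eq_signed_unitI)
      fix i assume "i < n"
      then show "A *\<^sub>v signed_unit n 1 i = multrow_mat n 0 s *\<^sub>v signed_unit n 1 i"
        using sj 0 by (cases "i = 0") (simp_all add: m)
    qed (use rot_hyperoctahedralD(1)[OF 0(2)] in auto)
    moreover from this have "s = 1"
      using rot_hyperoctahedralD(3)[OF 0(2)] det_multrow_mat[OF 0(1), of s] by simp
    moreover have "multrow_mat n 0 1 = (1\<^sub>m n :: real mat)"
      by (intro eq_matI) auto
    ultimately have "\<pi> \<one> = A" by (simp add: pi_one)
    then show ?case using tower_one by blast
  next
    case (Suc k)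
    obtain s j where sj: "s \<in> {1, - 1}" "j \<le> Suc k"
      "A *\<^sub>v signed_unit n 1 (Suc k) = signed_unit n s j"
      using vertex[OF Suc.prems] by blast
    obtain g where g: "g \<in> tower (Suc k)" "act g (signed_unit n 1 (Suc k)) = signed_unit n s j"
      using tower_transitive[OF Suc.prems(1) sj(2,1)] by blast
    have gcl: "g \<in> carrier G" using tower_closed g Suc.prems(1) by blast
    have Ac: "A \<in> carrier_mat n n" using rot_hyperoctahedralD(1)[OF Suc.prems(2)] .
    define B where "B = \<pi> (inv g) * A"
    have B: "B \<in> carrier (rot_hyperoctahedral_group n)"
      using group.is_monoid[OF group_rot_hyperoctahedral_group, THEN monoid.m_closed]
        pi_carrier[of "inv g"] gcl Suc.prems(2)
      by (auto simp: B_def rot_hyperoctahedral_simps)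
    have Bact: "B *\<^sub>v v = act (inv g) (A *\<^sub>v v)" if "v \<in> carrier_vec n" for v
      using that gcl Ac pi_mat[of "inv g"]
      by (simp add: B_def act_def assoc_mult_mat_vec[of _ n n _ n])
    have "B *\<^sub>v signed_unit n 1 j = signed_unit n 1 j" if "k < j" "j < n" for j
    proof (cases "j = Suc k")
      case True
      then show ?thesis using g sj gcl by (simp add: Bact act_inv_fix)
    next
      case False
      then have "act g (signed_unit n 1 j) = signed_unit n 1 j"
        using that Suc.prems(1) g(1) act_tower_fixes[of "Suc k" g j 1] by simp
      then show ?thesis using that False Suc.prems(3)[of j] gcl by (simp add: Bact act_inv_fix)
    qed
    then obtain h where h: "h \<in> tower k" "\<pi> h = B" using Suc.IH[of B] B Suc.prems(1) by auto
    have hS: "h \<in> tower (Suc k)" using h tower_mono[of k "Suc k"] Suc.prems(1) by auto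
    then have "h \<in> carrier G" using tower_closed Suc.prems(1) by blast
    then have "\<pi> (g \<otimes> h) = \<pi> g * (\<pi> (inv g) * A)" using gcl by (simp add: pi_mult h B_def)
    also have "\<dots> = (\<pi> g * \<pi> (inv g)) * A"
      using gcl Ac pi_mat by (intro assoc_mult_mat[symmetric, of _ n n _ n _ n]) auto
    also have "\<dots> = \<pi> (g \<otimes> inv g) * A" using gcl by (simp only: pi_mult inv_closed)
    also have "\<dots> = A" using gcl Ac by (simp add: pi_one)
    finally show ?case using tower_mult[OF Suc.prems(1) g(1) hS] by blast
  }
qed

end

section \<open>The presented group\<close>

definition quotient_relations :: "nat \<Rightarrow> (nat gword \<times> nat gword) set"
  where "quotient_relations n =
    braid_relations n \<union> {([gen 1, gen 1], [gen 2, gen 1, gen 1, gen 2])}"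

definition word_class :: "nat \<Rightarrow> nat gword \<Rightarrow> nat gword set"
  where "word_class n w = pres_rel {1..n - 1} (quotient_relations n) `` {w}"

definition braid_gen :: "nat \<Rightarrow> nat \<Rightarrow> nat gword set"
  where "braid_gen n i = word_class n [gen i]"

lemma braid_quotient_alt: "braid_quotient n = presented_group {1..n - 1} (quotient_relations n)"
  by (simp only: braid_quotient_def quotient_relations_def)

lemma group_braid_quotient: "group (braid_quotient n)"
  unfolding braid_quotient_alt by (rule group_presented_group)

lemma word_class_closed: "w \<in> gwords {1..n - 1} \<Longrightarrow> word_class n w \<in> carrier (braid_quotient n)"
  unfolding braid_quotient_alt word_class_def by (rule presented_group_class_closed)

lemma word_class_mult:
  "u \<in> gwords {1..n - 1} \<Longrightarrow> v \<in> gwords {1..n - 1} \<Longrightarrow>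
    word_class n u \<otimes>\<^bsub>braid_quotient n\<^esub> word_class n v = word_class n (u @ v)"
  unfolding braid_quotient_alt word_class_def by (rule presented_group_mult)

lemma word_class_one: "word_class n [] = \<one>\<^bsub>braid_quotient n\<^esub>"
  by (simp add: braid_quotient_alt word_class_def presented_group_def)

lemma word_class_eqI:
  assumes "pres_eq {1..n - 1} (quotient_relations n) u v"
  shows "word_class n u = word_class n v"
  using pres_eq_gwords[OF assms] pres_class_eq_iff assms unfolding word_class_def by blast

lemma word_class_relation:
  "(u, v) \<in> quotient_relations n \<Longrightarrow> u \<in> gwords {1..n - 1} \<Longrightarrow> v \<in> gwords {1..n - 1} \<Longrightarrow>
    word_class n u = word_class n v"
  by (intro word_class_eqI pres_eq.relation)

lemma braid_gen_closed: "1 \<le> i \<Longrightarrow> i < n \<Longrightarrow> braid_gen n i \<in> carrier (braid_quotient n)"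
  unfolding braid_gen_def by (rule word_class_closed) auto

text \<open>The universal property, with the relations written as equations between products.\<close>

lemma braid_quotient_hom:
  assumes "group H" "3 \<le> n"
    and f: "\<And>i. 1 \<le> i \<Longrightarrow> i < n \<Longrightarrow> f i \<in> carrier H"
    and braid: "\<And>i. 1 \<le> i \<Longrightarrow> i + 1 < n \<Longrightarrow>
      f i \<otimes>\<^bsub>H\<^esub> (f (i + 1) \<otimes>\<^bsub>H\<^esub> f i) = f (i + 1) \<otimes>\<^bsub>H\<^esub> (f i \<otimes>\<^bsub>H\<^esub> f (i + 1))"
    and far: "\<And>i j. 1 \<le> i \<Longrightarrow> i + 2 \<le> j \<Longrightarrow> j < n \<Longrightarrow> f i \<otimes>\<^bsub>H\<^esub> f j = f j \<otimes>\<^bsub>H\<^esub> f i"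
    and extra: "f 1 \<otimes>\<^bsub>H\<^esub> f 1 = f 2 \<otimes>\<^bsub>H\<^esub> (f 1 \<otimes>\<^bsub>H\<^esub> (f 1 \<otimes>\<^bsub>H\<^esub> f 2))"
  shows "\<exists>h\<in>hom (braid_quotient n) H. \<forall>i. 1 \<le> i \<and> i < n \<longrightarrow> h (braid_gen n i) = f i"
proof -
  interpret H: group H by fact
  have fS: "f \<in> {1..n - 1} \<rightarrow> carrier H" using f assms(2) by auto
  have ev: "eval_gword H f (gen i # w) = f i \<otimes>\<^bsub>H\<^esub> eval_gword H f w"
    "eval_gword H f [] = \<one>\<^bsub>H\<^esub>" for i w
    by (simp_all add: eval_gword_def)
  have "eval_gword H f u = eval_gword H f v" if uv: "(u, v) \<in> quotient_relations n" for u v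
  proof -
    consider i where "1 \<le> i" "i \<le> n - 2" "u = [gen i, gen (i + 1), gen i]"
        "v = [gen (i + 1), gen i, gen (i + 1)]"
      | i j where "i \<in> {1..n - 1}" "j \<in> {1..n - 1}" "\<bar>int i - int j\<bar> \<ge> 2"
        "u = [gen i, gen j]" "v = [gen j, gen i]"
      | "u = [gen 1, gen 1]" "v = [gen 2, gen 1, gen 1, gen 2]"
      using uv unfolding quotient_relations_def braid_relations_def by blast
    then show ?thesis
    proof cases
      case 1
      moreover from this have "f i \<in> carrier H" "f (i + 1) \<in> carrier H"
        using assms(2) by (auto intro: f)
      moreover have "i + 1 < n" using 1 assms(2) by auto
      ultimately show ?thesis using braid[of i] by (simp add: ev)
    next
      case 2
      then have "f i \<in> carrier H" "f j \<in> carrier H" "i + 2 \<le> j \<or> j + 2 \<le> i" "i < n" "j < n"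
        using assms(2) by (auto intro: f)
      then show ?thesis using 2 far[of i j] far[of j i] by (auto simp: ev)
    next
      case 3
      have "f 1 \<in> carrier H" "f 2 \<in> carrier H" using assms(2) by (auto intro: f)
      then show ?thesis using 3 extra by (simp add: ev)
    qed
  qed
  then obtain h where h: "h \<in> hom (braid_quotient n) H"
    "\<forall>w\<in>gwords {1..n - 1}. h (word_class n w) = eval_gword H f w"
    using H.presented_group_hom[OF fS, of "quotient_relations n"]
    unfolding word_class_def braid_quotient_alt by blast
  have "h (braid_gen n i) = f i" if "1 \<le> i" "i < n" for i
    using that f[of i] unfolding braid_gen_def by (subst h(2)[rule_format]) (auto simp: ev)
  with h(1) show ?thesis by blast
qed

lemma braid_quotient_elements_braid_gen:
  assumes "3 \<le> n"
  shows "braid_quotient_elements (braid_quotient n) (braid_gen n) n"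
proof -
  interpret group "braid_quotient n" by (rule group_braid_quotient)
  show ?thesis
  proof unfold_locales
    fix i assume i: "1 \<le> i" "Suc i < n"
    then have mem: "i \<in> {1..n - 1}" "Suc i \<in> {1..n - 1}" by auto
    have "word_class n [gen i, gen (Suc i), gen i] = word_class n [gen (Suc i), gen i, gen (Suc i)]"
      using i mem by (intro word_class_relation) (auto simp: quotient_relations_def braid_relations_def)
    then show "braid_gen n i \<otimes>\<^bsub>braid_quotient n\<^esub> (braid_gen n (Suc i) \<otimes>\<^bsub>braid_quotient n\<^esub> braid_gen n i) =
        braid_gen n (Suc i) \<otimes>\<^bsub>braid_quotient n\<^esub> (braid_gen n i \<otimes>\<^bsub>braid_quotient n\<^esub> braid_gen n (Suc i))"
      using mem by (simp add: braid_gen_def word_class_mult del: One_nat_def)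
  next
    fix i j :: nat assume i: "1 \<le> i" "i + 2 \<le> j" "j < n"
    then have mem: "i \<in> {1..n - 1}" "j \<in> {1..n - 1}" by auto
    have "word_class n [gen i, gen j] = word_class n [gen j, gen i]"
      using i mem by (intro word_class_relation) (auto simp: quotient_relations_def braid_relations_def)
    then show "braid_gen n i \<otimes>\<^bsub>braid_quotient n\<^esub> braid_gen n j = braid_gen n j \<otimes>\<^bsub>braid_quotient n\<^esub> braid_gen n i"
      using mem by (simp add: braid_gen_def word_class_mult del: One_nat_def)
  next
    have mem: "1 \<in> {1..n - 1}" "2 \<in> {1..n - 1}" using assms by auto
    have "braid_gen n 1 \<otimes>\<^bsub>braid_quotient n\<^esub> braid_gen n 1 = word_class n [gen 1, gen 1]"
      using mem by (simp add: braid_gen_def word_class_mult del: One_nat_def)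
    also have "\<dots> = word_class n [gen 2, gen 1, gen 1, gen 2]"
      using mem by (intro word_class_relation) (auto simp: quotient_relations_def)
    also have "\<dots> = braid_gen n 2 \<otimes>\<^bsub>braid_quotient n\<^esub>
        (braid_gen n 1 \<otimes>\<^bsub>braid_quotient n\<^esub> braid_gen n 1 \<otimes>\<^bsub>braid_quotient n\<^esub> braid_gen n 2)"
      using mem by (simp add: braid_gen_def word_class_mult del: One_nat_def)
    finally show "braid_gen n 1 \<otimes>\<^bsub>braid_quotient n\<^esub> braid_gen n 1 =
        braid_gen n 2 \<otimes>\<^bsub>braid_quotient n\<^esub>
          (braid_gen n 1 \<otimes>\<^bsub>braid_quotient n\<^esub> braid_gen n 1 \<otimes>\<^bsub>braid_quotient n\<^esub> braid_gen n 2)" .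
  qed (use assms braid_gen_closed in auto)
qed

lemma braid_quotient_generated:
  assumes "g \<in> carrier (braid_quotient n)"
  shows "g \<in> generate (braid_quotient n) (braid_gen n ` {1..n - 1})"
proof -
  let ?S = "{1..n - 1}" and ?G = "braid_quotient n"
  interpret group ?G by (rule group_braid_quotient)
  have "word_class n w \<in> generate ?G (braid_gen n ` ?S)" if "w \<in> gwords ?S" for w
    using that
  proof (induction w rule: list.induct)
    case Nil
    then show ?case by (simp only: word_class_one generate.one)
  next
    case (Cons x w)
    obtain i b where x: "x = (i, b)" by (cases x)
    have i: "i \<in> ?S" and w: "w \<in> gwords ?S" using Cons.prems x by simp_all
    have gen_mem: "braid_gen n i \<in> braid_gen n ` ?S" using i by blast
    have "word_class n [(i, b)] \<in> generate ?G (braid_gen n ` ?S)"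
    proof (cases b)
      case True
      then show ?thesis using generate.incl[OF gen_mem] by (simp only: braid_gen_def)
    next
      case False
      have "word_class n [(i, False)] \<otimes>\<^bsub>?G\<^esub> braid_gen n i = word_class n ([(i, False)] @ [gen i])"
        unfolding braid_gen_def using i by (intro word_class_mult) auto
      also have "\<dots> = word_class n []"
        using pres_eq.cancel[OF i, of "quotient_relations n" False] by (intro word_class_eqI) simp
      finally have "word_class n [(i, False)] \<otimes>\<^bsub>?G\<^esub> braid_gen n i = \<one>\<^bsub>?G\<^esub>"
        by (simp only: word_class_one)
      moreover have "word_class n [(i, False)] \<in> carrier ?G"
        using i by (intro word_class_closed) auto
      moreover have "braid_gen n i \<in> carrier ?G" using i by (intro braid_gen_closed) auto
      ultimately have "inv\<^bsub>?G\<^esub> (braid_gen n i) = word_class n [(i, b)]" using False inv_equality by simp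
      then show ?thesis using generate.inv[OF gen_mem, of ?G] by simp
    qed
    then have "word_class n [(i, b)] \<otimes>\<^bsub>?G\<^esub> word_class n w \<in> generate ?G (braid_gen n ` ?S)"
      using Cons.IH[OF w] by (rule generate.eng)
    then show ?case using word_class_mult[of "[(i, b)]" n w] i w by (simp add: x)
  qed
  then show ?thesis
    using assms unfolding braid_quotient_alt word_class_def by (elim presented_group_carrierE) simp
qed

section \<open>A spin representation\<close>

definition flip :: "nat \<Rightarrow> (nat \<Rightarrow> bool) \<Rightarrow> nat \<Rightarrow> bool"
  where "flip i s = s(i := \<not> s i)"

text \<open>The operator \<open>J\<^sub>i f = (\<lambda>s. chi i s * f (flip i s))\<close> plays the role of \<open>e\<^sub>i e\<^sub>i\<^sub>+\<^sub>1\<close>. A flip of coordinate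
  \<open>i\<close> changes the sign of \<open>chi j\<close> exactly for \<open>j = i\<close> and \<open>j = i - 1\<close>. The former gives
  \<open>J\<^sub>i\<^sup>2 = - 1\<close>; the latter makes neighbouring operators anticommute, and all others commute.\<close>

definition chi :: "nat \<Rightarrow> (nat \<Rightarrow> bool) \<Rightarrow> real"
  where "chi i s = (if s i = s (Suc i) then 1 else - 1)"

text \<open>\<open>(1 + e J\<^sub>i) / \<surd>2\<close>; the sign \<open>e = - 1\<close> gives the inverse of the operator for \<open>e = 1\<close>.\<close>

definition spin :: "nat \<Rightarrow> real \<Rightarrow> ((nat \<Rightarrow> bool) \<Rightarrow> real) \<Rightarrow> (nat \<Rightarrow> bool) \<Rightarrow> real"
  where "spin i e f = (\<lambda>s. (f s + e * chi i s * f (flip i s)) / sqrt 2)"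

lemma flip_flip: "flip i (flip i s) = s"
  by (simp add: flip_def fun_eq_iff)

lemma flip_commute: "flip i (flip j s) = flip j (flip i s)"
  by (auto simp: flip_def fun_eq_iff)

lemma chi_flip:
  "chi i (flip i s) = - chi i s"
  "chi i (flip (Suc i) s) = - chi i s"
  "j \<noteq> i \<Longrightarrow> j \<noteq> Suc i \<Longrightarrow> chi i (flip j s) = chi i s"
  by (auto simp: chi_def flip_def)

lemma chi_square: "chi i s * chi i s = 1" "chi i s * (chi i s * x) = x"
  by (auto simp: chi_def)

lemma spin_inverse: "spin i 1 (spin i (- 1) f) = f" "spin i (- 1) (spin i 1 f) = f"
  by (rule ext, simp add: spin_def flip_flip chi_flip chi_square field_simps)+

lemma spin_square: "spin i 1 (spin i 1 f) = (\<lambda>s. chi i s * f (flip i s))"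
  by (rule ext) (simp add: spin_def flip_flip chi_flip chi_square field_simps)

lemma spin_braid:
  "spin i 1 (spin (Suc i) 1 (spin i 1 f)) = spin (Suc i) 1 (spin i 1 (spin (Suc i) 1 f))"
  by (rule ext)
    (simp add: spin_def flip_flip chi_flip chi_square flip_commute[of "Suc i" i] field_simps)

lemma spin_far_commute:
  assumes "i + 2 \<le> j"
  shows "spin i 1 (spin j 1 f) = spin j 1 (spin i 1 f)"
  using assms
  by (intro ext) (simp add: spin_def flip_flip chi_flip chi_square flip_commute[of j i] field_simps)

lemma spin_lower_square: "spin (Suc i) 1 (spin i 1 (spin i 1 (spin (Suc i) 1 f))) = spin i 1 (spin i 1 f)"
  unfolding spin_square
  by (rule ext)
    (simp add: spin_def flip_flip chi_flip chi_square flip_commute[of "Suc i" i] field_simps)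

lemma spin_Bij: "spin i 1 \<in> carrier (BijGroup UNIV)"
proof -
  have "bij (spin i 1)"
    by (rule o_bij[of "spin i (- 1)"]) (auto simp: fun_eq_iff[of "_ \<circ> _"] spin_inverse)
  then show ?thesis by (simp add: BijGroup_def Bij_def)
qed

lemma BijGroup_mult:
  "f \<in> carrier (BijGroup UNIV) \<Longrightarrow> g \<in> carrier (BijGroup UNIV) \<Longrightarrow> f \<otimes>\<^bsub>BijGroup UNIV\<^esub> g = f \<circ> g"
  by (auto simp: BijGroup_def compose_def fun_eq_iff)

lemma BijGroup_comp_closed:
  "f \<in> carrier (BijGroup UNIV) \<Longrightarrow> g \<in> carrier (BijGroup UNIV) \<Longrightarrow> f \<circ> g \<in> carrier (BijGroup UNIV)"
  by (simp add: BijGroup_def Bij_def bij_comp)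

text \<open>\<open>z\<close> acts as \<open>J\<^sub>1\<^sup>2 = - 1\<close> and hence moves the constant function 1.\<close>

lemma z_neq_one:
  assumes "3 \<le> n"
  shows "braid_quotient_elements.z (braid_quotient n) (braid_gen n) \<noteq> \<one>\<^bsub>braid_quotient n\<^esub>"
proof
  let ?G = "braid_quotient n"
  let ?H = "BijGroup UNIV :: (((nat \<Rightarrow> bool) \<Rightarrow> real) \<Rightarrow> (nat \<Rightarrow> bool) \<Rightarrow> real) monoid"
  interpret braid_quotient_elements ?G "braid_gen n" n
    by (rule braid_quotient_elements_braid_gen) fact
  interpret H: group ?H by (rule group_BijGroup)
  assume z: "z = \<one>\<^bsub>?G\<^esub>"
  note comp = BijGroup_mult BijGroup_comp_closed spin_Bij fun_eq_iff[of "_ \<circ> _"]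
  have braid: "spin i 1 \<otimes>\<^bsub>?H\<^esub> (spin (i + 1) 1 \<otimes>\<^bsub>?H\<^esub> spin i 1) =
      spin (i + 1) 1 \<otimes>\<^bsub>?H\<^esub> (spin i 1 \<otimes>\<^bsub>?H\<^esub> spin (i + 1) 1)" for i
    by (simp add: comp spin_braid)
  have far: "spin i 1 \<otimes>\<^bsub>?H\<^esub> spin j 1 = spin j 1 \<otimes>\<^bsub>?H\<^esub> spin i 1" if "i + 2 \<le> j" for i j
    using spin_far_commute[OF that] by (simp add: comp)
  have first: "spin 1 1 \<otimes>\<^bsub>?H\<^esub> spin 1 1 =
      spin 2 1 \<otimes>\<^bsub>?H\<^esub> (spin 1 1 \<otimes>\<^bsub>?H\<^esub> (spin 1 1 \<otimes>\<^bsub>?H\<^esub> spin 2 1))"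
    using spin_lower_square[of 1] by (simp add: comp numeral_2_eq_2)
  obtain h where h: "h \<in> hom ?G ?H" "\<forall>i. 1 \<le> i \<and> i < n \<longrightarrow> h (braid_gen n i) = spin i 1"
    using braid_quotient_hom[where f = "\<lambda>i. spin i 1", OF H.is_group assms spin_Bij braid far first]
    by blast
  have "braid_gen n 1 \<in> carrier ?G" using assms by (intro r_closed) auto
  then have "h z = (spin 1 1 \<otimes>\<^bsub>?H\<^esub> spin 1 1) \<otimes>\<^bsub>?H\<^esub> (spin 1 1 \<otimes>\<^bsub>?H\<^esub> spin 1 1)"
    using h assms by (simp add: z_def a_def hom_mult[OF h(1)])
  then have hz: "h z f = spin 1 1 (spin 1 1 (spin 1 1 (spin 1 1 f)))" for f
    by (simp add: BijGroup_mult spin_Bij BijGroup_comp_closed)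
  have "h z = \<one>\<^bsub>?H\<^esub>"
    using z hom_one[OF h(1) is_group H.is_group] by simp
  then have "h z (\<lambda>_. 1) (\<lambda>_. True) = 1" by (simp add: BijGroup_def)
  then show False by (simp add: hz spin_square chi_flip chi_square)
qed

section \<open>The central extension\<close>

theorem mainTheorem3:
  fixes n :: nat
  assumes "n \<ge> 3"
  shows "Coset.order (braid_quotient n) = 2 ^ n * fact n \<and>
    (\<exists>\<iota> \<pi>. central_extension (integer_mod_group 2) (braid_quotient n)
        (rot_hyperoctahedral_group n) \<iota> \<pi> \<and>
      \<not> extension_splits (braid_quotient n) (rot_hyperoctahedral_group n) \<pi>)"
proof -
  let ?G = "braid_quotient n" and ?Q = "rot_hyperoctahedral_group n"
  interpret Q: group ?Q by (rule group_rot_hyperoctahedral_group)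
  obtain \<pi> where pi: "\<pi> \<in> hom ?G ?Q" "\<forall>i. 1 \<le> i \<and> i < n \<longrightarrow> \<pi> (braid_gen n i) = quarter_turn n i"
    using braid_quotient_hom[OF Q.is_group assms, of "quarter_turn n", unfolded rot_hyperoctahedral_simps,
      OF quarter_turn_in_group quarter_turn_braid quarter_turn_far_commute quarter_turn_first_square[OF assms]] by blast
  interpret braid_rotation ?G "braid_gen n" n \<pi>
    using assms pi
    by (intro braid_rotation.intro braid_rotation_axioms.intro braid_quotient_elements_braid_gen) auto
  have z1: "z \<noteq> \<one>\<^bsub>?G\<^esub>" using z_neq_one[OF assms] .
  have n: "n - 1 < n" using assms by simp
  have tower_top: "tower (n - 1) = carrier ?G"
  proof
    show "tower (n - 1) \<subseteq> carrier ?G" using tower_closed[OF n] by blast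
    have "generate ?G (braid_gen n ` {1..n - 1}) \<subseteq> tower (n - 1)"
      unfolding tower_def by (rule mono_generate) auto
    then show "carrier ?G \<subseteq> tower (n - 1)" using braid_quotient_generated by blast
  qed
  have order: "Coset.order ?G = 2 ^ n * fact n"
    using card_tower[OF z1 n] assms unfolding Coset.order_def tower_top by simp
  define \<iota> where "\<iota> k = (if k = 0 then \<one>\<^bsub>?G\<^esub> else z)" for k :: int
  have C2: "carrier (integer_mod_group 2) = {0, 1}"
    by (auto simp: carrier_integer_mod_group)
  have "\<iota> \<in> mon (integer_mod_group 2) ?G"
    using z1 z_closed z_square
    by (auto simp: mon_def hom_def inj_on_def C2 \<iota>_def)
  moreover have "\<pi> \<in> epi ?G ?Q"
  proof -
    have "\<exists>g\<in>carrier ?G. \<pi> g = A" if "A \<in> carrier ?Q" for A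
      using pi_surj[OF n that] tower_top by auto
    then show ?thesis using pi(1) by (auto simp: epi_def hom_def)
  qed
  moreover have "\<iota> ` carrier (integer_mod_group 2) = kernel ?G ?Q \<pi>"
  proof -
    have "kernel ?G ?Q \<pi> = {\<one>\<^bsub>?G\<^esub>, z}"
      using kernel_in_tower[OF _ n] tower_top pi_one pi_z z_closed
      by (auto simp: kernel_def rot_hyperoctahedral_simps)
    then show ?thesis by (auto simp: C2 \<iota>_def)
  qed
  moreover have "\<iota> x \<otimes>\<^bsub>?G\<^esub> g = g \<otimes>\<^bsub>?G\<^esub> \<iota> x" if "g \<in> carrier ?G" for x g
    using that z_central[OF n, unfolded tower_top, of g] by (simp add: \<iota>_def)
  ultimately have ext: "central_extension (integer_mod_group 2) ?G ?Q \<iota> \<pi>"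
    by (simp add: central_extension_def group_extension_def is_group Q.is_group)
  \<comment> \<open>A lift of the quarter turn is \<open>R\<^sub>1 c\<close> with \<open>c\<close> in the kernel. As \<open>c\<close> is central with \<open>c\<^sup>2 = 1\<close>, its
    fourth power is \<open>z\<close>, not \<open>1\<close>.\<close>
  have "\<not> extension_splits ?G ?Q \<pi>"
  proof
    assume "extension_splits ?G ?Q \<pi>"
    then obtain \<sigma> where \<sigma>: "\<sigma> \<in> hom ?Q ?G" "\<And>q. q \<in> carrier ?Q \<Longrightarrow> \<pi> (\<sigma> q) = q"
      by (auto simp: extension_splits_def)
    let ?r = "braid_gen n 1" and ?s = "\<sigma> (quarter_turn n 1)"
    have r: "?r \<in> carrier ?G" "quarter_turn n 1 \<in> carrier ?Q" "\<pi> ?r = quarter_turn n 1"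
      using assms pi(2) by (auto simp: r_closed quarter_turn_in_group)
    have s: "?s \<in> carrier ?G" using \<sigma>(1) r by (auto simp: hom_def)
    have pow4: "\<pi> z = (\<pi> ?r \<otimes>\<^bsub>?Q\<^esub> \<pi> ?r) \<otimes>\<^bsub>?Q\<^esub> (\<pi> ?r \<otimes>\<^bsub>?Q\<^esub> \<pi> ?r)"
      using r by (simp add: z_def a_def hom_mult[OF pi(1)])
    have "\<pi> (inv\<^bsub>?G\<^esub> ?r \<otimes>\<^bsub>?G\<^esub> ?s) = inv\<^bsub>?Q\<^esub> (quarter_turn n 1) \<otimes>\<^bsub>?Q\<^esub> quarter_turn n 1"
      using r s \<sigma>(2)[OF r(2)] hom_mult[OF pi(1)]
        group_hom.hom_inv[of ?G ?Q \<pi> ?r] pi(1)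
      by (simp add: group_hom_def group_hom_axioms_def is_group Q.is_group)
    then have "\<pi> (inv\<^bsub>?G\<^esub> ?r \<otimes>\<^bsub>?G\<^esub> ?s) = 1\<^sub>m n"
      using r Q.l_inv[OF r(2)] by (simp add: rot_hyperoctahedral_simps)
    then have "inv\<^bsub>?G\<^esub> ?r \<otimes>\<^bsub>?G\<^esub> ?s \<in> {\<one>\<^bsub>?G\<^esub>, z}"
      using r s by (intro kernel_in_tower[OF _ n]) (unfold tower_top, auto)
    then obtain c where c: "c \<in> {\<one>\<^bsub>?G\<^esub>, z}" "inv\<^bsub>?G\<^esub> ?r \<otimes>\<^bsub>?G\<^esub> ?s = c" by blast
    have ccl: "c \<in> carrier ?G" "c \<otimes>\<^bsub>?G\<^esub> c = \<one>\<^bsub>?G\<^esub>" "c \<otimes>\<^bsub>?G\<^esub> ?r = ?r \<otimes>\<^bsub>?G\<^esub> c"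
      using c(1) z_closed z_square z_commute[of 1] r assms by auto
    have "?s = ?r \<otimes>\<^bsub>?G\<^esub> c"
      using r s by (simp flip: c(2) m_assoc)
    then have "?s \<otimes>\<^bsub>?G\<^esub> ?s = ?r \<otimes>\<^bsub>?G\<^esub> ((c \<otimes>\<^bsub>?G\<^esub> ?r) \<otimes>\<^bsub>?G\<^esub> c)"
      using r ccl(1) by (simp add: m_assoc)
    also have "\<dots> = (?r \<otimes>\<^bsub>?G\<^esub> ?r) \<otimes>\<^bsub>?G\<^esub> (c \<otimes>\<^bsub>?G\<^esub> c)"
      unfolding ccl(3) using r ccl(1) by (simp add: m_assoc)
    also have "\<dots> = a 1" using r by (simp add: ccl(2) a_def)
    finally have ss: "?s \<otimes>\<^bsub>?G\<^esub> ?s = a 1" .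
    have "\<sigma> (\<pi> z) = (?s \<otimes>\<^bsub>?G\<^esub> ?s) \<otimes>\<^bsub>?G\<^esub> (?s \<otimes>\<^bsub>?G\<^esub> ?s)"
      unfolding pow4 r(3) using r(2) by (simp add: hom_mult[OF \<sigma>(1)])
    also have "\<dots> = z" by (simp only: ss z_def)
    finally have "\<sigma> (\<pi> z) = z" .
    moreover have "\<sigma> (\<pi> z) = \<one>\<^bsub>?G\<^esub>"
      using hom_one[OF \<sigma>(1) Q.is_group is_group] by (simp add: pi_z rot_hyperoctahedral_simps)
    ultimately show False using z1 by simp
  qed
  with order ext show ?thesis by blast
qed

end
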